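(* Define rational functions in $\mathbb{Q}(t)$ by $$\varepsilon=-\frac{t^3-t^2+5t+1}{t},\qquad \rho=\frac{t^3-2t^2+7t+2}{t},$$ $$\eta=-\frac{t^6+t^5+2t^4+3t^3-2t^2-5t-1}{t(t-1)(t+1)^2},\qquad \kappa=\frac{t^5+2t^4+3t^3-5t-2}{t(t^2-1)}.$$ The sets $C_n(\mathbb{Q})\subseteq\mathbb{A}^2(\mathbb{Q})$, $n\in\{2,3,4\}$, are described by $$C_2(\mathbb{Q})=\{(v,-2v):v\in\mathbb{Q}\},$$ $$C_3(\mathbb{Q})=\{(\varepsilon(v),\rho(v)):v\in\mathbb{Q}\setminus\{0\}\},$$ $$C_4(\mathbb{Q})=\{(\eta(v),\kappa(v)):v\in\mathbb{Q}\setminus\{0,\pm1\}\}.$$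
   Context: For a degree-two $\phi\in\overline{\mathbb{Q}}(x)$, let $[\phi]$ denote its conjugacy class under degree-one elements of $\overline{\mathbb{Q}}(x)$ (acting by $\sigma^{-1}\circ\phi\circ\sigma$), and let $\mathcal{M}_2(\overline{\mathbb{Q}})$ be the set of such classes. The multiplier of $\phi$ at a fixed point $P$ is $\phi'(P)$ (computed after conjugating if $P=\infty$). There is a bijection $\mathcal{M}_2(\overline{\mathbb{Q}})\to\mathbb{A}^2(\overline{\mathbb{Q}})$, $[\phi]\mapsto(\sigma_1,\sigma_2)$, where $\sigma_i$ is the $i$th elementary symmetric function of the multipliers of the three fixed points of $\phi$ (counted with multiplicity). $C_n\subseteq\mathbb{A}^2(\overline{\mathbb{Q}})$ is the image of the set of classes $[\phi]$ such that $\phi$ has a critical point in $\mathbb{P}^1(\overline{\mathbb{Q}})$ that is periodic with exact period $n$; it is the set of points of an algebraic curve defined over $\mathbb{Q}$, and $C_n(\mathbb{Q})=C_n\cap\mathbb{A}^2(\mathbb{Q})$. *)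

theory Defs
  imports
    "HOL-Computational_Algebra.Computational_Algebra"
    "HOL-Algebra.Algebraic_Closure_Type"
begin

type_synonym qbar = "rat alg_closure"

type_synonym ratfun = "qbar poly fract"

datatype P1 = Fin qbar | Infty

section \<open>Rational functions\<close>

text \<open>Numerator and denominator of a rational function in lowest terms (the denominator is monic).\<close>

definition rf_num :: "ratfun \<Rightarrow> qbar poly" where
  "rf_num \<phi> = fst (quot_of_fract \<phi>)"

definition rf_den :: "ratfun \<Rightarrow> qbar poly" where
  "rf_den \<phi> = snd (quot_of_fract \<phi>)"

definition rf_degree :: "ratfun \<Rightarrow> nat" where
  "rf_degree \<phi> = max (degree (rf_num \<phi>)) (degree (rf_den \<phi>))"

definition rf_const :: "qbar \<Rightarrow> ratfun" where
  "rf_const c = to_fract [:c:]"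

definition rf_X :: ratfun where
  "rf_X = to_fract [:0, 1:]"

text \<open>
  The composition \<open>\<phi> \<circ> \<psi>\<close>, computed by substituting \<open>\<psi>\<close> into numerator and denominator of \<open>\<phi>\<close>.
  It is used only for non-constant \<open>\<psi>\<close>, for which the denominator does not become \<open>0\<close>.
\<close>

definition rf_comp :: "ratfun \<Rightarrow> ratfun \<Rightarrow> ratfun" where
  "rf_comp \<phi> \<psi> =
     poly (map_poly rf_const (rf_num \<phi>)) \<psi> / poly (map_poly rf_const (rf_den \<phi>)) \<psi>"

text \<open>The conjugate of \<open>\<phi>\<close> by \<open>1/x\<close>, that is \<open>1 / \<phi>(1/x)\<close>; it exchanges \<open>0\<close> and \<open>\<infinity>\<close>.\<close>

definition rf_flip :: "ratfun \<Rightarrow> ratfun" where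
  "rf_flip \<phi> = inverse (rf_comp \<phi> (inverse rf_X))"

definition rf_eval_fin :: "ratfun \<Rightarrow> qbar \<Rightarrow> P1" where
  "rf_eval_fin \<phi> a =
     (if poly (rf_den \<phi>) a = 0 then Infty else Fin (poly (rf_num \<phi>) a / poly (rf_den \<phi>) a))"

definition rf_eval :: "ratfun \<Rightarrow> P1 \<Rightarrow> P1" where
  "rf_eval \<phi> P =
     (case P of
        Fin a \<Rightarrow> rf_eval_fin \<phi> a
      | Infty \<Rightarrow> rf_eval_fin (rf_comp \<phi> (inverse rf_X)) 0)"

text \<open>The value \<open>\<phi>'(a)\<close> by the quotient rule; meaningful only if \<open>a\<close> is not a pole of \<open>\<phi>\<close>.\<close>

definition rf_deriv :: "ratfun \<Rightarrow> qbar \<Rightarrow> qbar" where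
  "rf_deriv \<phi> a =
     poly (pderiv (rf_num \<phi>) * rf_den \<phi> - rf_num \<phi> * pderiv (rf_den \<phi>)) a
       / (poly (rf_den \<phi>) a)\<^sup>2"

section \<open>Conjugacy classes of maps of degree two\<close>

definition conj_rel :: "(ratfun \<times> ratfun) set" where
  "conj_rel =
     {(\<phi>, \<psi>). rf_degree \<phi> = 2 \<and> rf_degree \<psi> = 2 \<and>
       (\<exists>\<sigma> \<tau>. rf_degree \<sigma> = 1 \<and> rf_degree \<tau> = 1 \<and>
          rf_comp \<sigma> \<tau> = rf_X \<and> rf_comp \<tau> \<sigma> = rf_X \<and>
          \<psi> = rf_comp \<tau> (rf_comp \<phi> \<sigma>))}"

definition conj_class :: "ratfun \<Rightarrow> ratfun set" where
  "conj_class \<phi> = conj_rel `` {\<phi>}"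

section \<open>Fixed points and multipliers\<close>

definition fixed_points :: "ratfun \<Rightarrow> P1 set" where
  "fixed_points \<phi> = {P. rf_eval \<phi> P = P}"

text \<open>
  The multiplicity of a finite fixed point \<open>a\<close> of \<open>\<phi> = p/q\<close> is its multiplicity as a root
  of \<open>p - x q\<close>.
\<close>

definition fixed_order_fin :: "ratfun \<Rightarrow> qbar \<Rightarrow> nat" where
  "fixed_order_fin \<phi> a = order a (rf_num \<phi> - [:0, 1:] * rf_den \<phi>)"

definition fixed_order :: "ratfun \<Rightarrow> P1 \<Rightarrow> nat" where
  "fixed_order \<phi> P =
     (case P of Fin a \<Rightarrow> fixed_order_fin \<phi> a | Infty \<Rightarrow> fixed_order_fin (rf_flip \<phi>) 0)"

definition multiplier :: "ratfun \<Rightarrow> P1 \<Rightarrow> qbar" where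
  "multiplier \<phi> P =
     (case P of Fin a \<Rightarrow> rf_deriv \<phi> a | Infty \<Rightarrow> rf_deriv (rf_flip \<phi>) 0)"

text \<open>
  The \<open>i\<close>-th elementary symmetric function of the multipliers; a fixed point \<open>P\<close> of
  multiplicity \<open>m\<close> occurs as the \<open>m\<close> indices \<open>(P, 0), \<dots>, (P, m - 1)\<close>.
\<close>

definition fixed_points_with_mult :: "ratfun \<Rightarrow> (P1 \<times> nat) set" where
  "fixed_points_with_mult \<phi> = (SIGMA P : fixed_points \<phi>. {..<fixed_order \<phi> P})"

definition mult_sigma :: "nat \<Rightarrow> ratfun \<Rightarrow> qbar" where
  "mult_sigma i \<phi> =
     (\<Sum>S \<in> {S. S \<subseteq> fixed_points_with_mult \<phi> \<and> card S = i}. \<Prod>(P, k) \<in> S. multiplier \<phi> P)"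

text \<open>
  The coordinates \<open>(\<sigma>\<^sub>1, \<sigma>\<^sub>2)\<close> of a conjugacy class: the common value on all its members.
\<close>

definition moduli_coords :: "ratfun set \<Rightarrow> qbar \<times> qbar" where
  "moduli_coords c = the_elem ((\<lambda>\<phi>. (mult_sigma 1 \<phi>, mult_sigma 2 \<phi>)) ` c)"

section \<open>Periodic critical points\<close>

text \<open>
  At a finite point, \<open>\<phi>\<close> is critical iff its derivative vanishes there, where \<open>\<phi>\<close> is replaced
  by \<open>1/\<phi>\<close> (a coordinate change on the target) at a pole.
\<close>

definition critical_fin :: "ratfun \<Rightarrow> qbar \<Rightarrow> bool" where
  "critical_fin \<phi> a \<longleftrightarrow>
     (if rf_eval_fin \<phi> a = Infty then rf_deriv (inverse \<phi>) a = 0 else rf_deriv \<phi> a = 0)"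

definition critical_point :: "ratfun \<Rightarrow> P1 \<Rightarrow> bool" where
  "critical_point \<phi> P \<longleftrightarrow>
     (case P of
        Fin a \<Rightarrow> critical_fin \<phi> a
      | Infty \<Rightarrow> critical_fin (rf_comp \<phi> (inverse rf_X)) 0)"

definition exact_period :: "ratfun \<Rightarrow> P1 \<Rightarrow> nat \<Rightarrow> bool" where
  "exact_period \<phi> P n \<longleftrightarrow>
     0 < n \<and> (rf_eval \<phi> ^^ n) P = P \<and> (\<forall>m. 0 < m \<and> m < n \<longrightarrow> (rf_eval \<phi> ^^ m) P \<noteq> P)"

definition C :: "nat \<Rightarrow> (qbar \<times> qbar) set" where
  "C n = moduli_coords `
     {conj_class \<phi> | \<phi>. rf_degree \<phi> = 2 \<and> (\<exists>P. critical_point \<phi> P \<and> exact_period \<phi> P n)}"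

definition C_rat :: "nat \<Rightarrow> (rat \<times> rat) set" where
  "C_rat n = {(a, b). (of_rat a, of_rat b) \<in> C n}"

section \<open>The parametrisations\<close>

definition eps_fun :: "rat \<Rightarrow> rat" where
  "eps_fun t = - ((t^3 - t^2 + 5*t + 1) / t)"

definition rho_fun :: "rat \<Rightarrow> rat" where
  "rho_fun t = (t^3 - 2*t^2 + 7*t + 2) / t"

definition eta_fun :: "rat \<Rightarrow> rat" where
  "eta_fun t =
     - ((t^6 + t^5 + 2*t^4 + 3*t^3 - 2*t^2 - 5*t - 1) / (t * (t - 1) * (t + 1)^2))"

definition kappa_fun :: "rat \<Rightarrow> rat" where
  "kappa_fun t = (t^5 + 2*t^4 + 3*t^3 - 5*t - 2) / (t * (t^2 - 1))"

end

theory Submission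
  imports Defs
begin

text \<open>
  A quadratic map \<open>\<phi> = p/q\<close> is lifted to \<open>\<Phi>(x, y) = (P(x, y), Q(x, y))\<close> with binary quadratic forms
  \<open>P\<close>, \<open>Q\<close> that have no common zero. Everything in the statement can be read off \<open>\<Phi>\<close>. The fixed
  points are the lines on which the cubic form \<open>det(\<Phi>(v), v)\<close> vanishes, with the right
  multiplicities. By Euler's identity, if \<open>\<Phi>(v) = \<lambda>v\<close> then \<open>D\<Phi>(v)\<close> has the eigenvalues \<open>2\<lambda>\<close> and
  \<open>\<mu>\<lambda>\<close>, where \<open>\<mu>\<close> is the multiplier, so \<open>\<mu> = tr D\<Phi>(v) / \<lambda> - 2\<close>. In this form it is evident that
  conjugation does not change the multipliers, so that \<open>\<sigma>\<^sub>1\<close> and \<open>\<sigma>\<^sub>2\<close> are functions on classes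
  (\<open>mult_sigma_split\<close>, \<open>moduli_coords_conj_class\<close>).

  If a critical point \<open>P\<close> is not fixed, coordinates with \<open>P = \<infinity>\<close> and \<open>\<phi>(P) = 0\<close> turn \<open>\<phi>\<close> into
  \<open>a\<^sub>0 / (b\<^sub>0 + b\<^sub>1 x + b\<^sub>2 x\<^sup>2)\<close> (\<open>critical_normal_form\<close>). Period two means \<open>b\<^sub>0 = 0\<close>, which gives the line
  \<open>\<sigma>\<^sub>2 = -2\<sigma>\<^sub>1\<close>. For \<open>b\<^sub>0 \<noteq> 0\<close> the class depends only on \<open>w = b\<^sub>0 b\<^sub>1 / (a\<^sub>0 b\<^sub>2)\<close> and
  \<open>c = b\<^sub>0\<^sup>3 / (a\<^sub>0\<^sup>2 b\<^sub>2)\<close>, with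
  \<open>\<sigma>\<^sub>1 + 6 = w\<^sup>3 / c - 4w\<close> and \<open>\<sigma>\<^sub>2 + 2\<sigma>\<^sub>1 = 2w - w\<^sup>2 + 4c\<close>, and periods three and four become
  polynomial conditions on \<open>(w, c)\<close> that define rational curves; their parametrisations are the
  functions of the statement.

  What remains is to show that a rational point \<open>(\<sigma>\<^sub>1, \<sigma>\<^sub>2)\<close> comes from a rational parameter. A map has
  only two critical points, and correspondingly \<open>w\<close> satisfies a quadratic equation with coefficients
  in \<open>\<rat>(\<sigma>\<^sub>1, \<sigma>\<^sub>2)\<close> (\<open>moduli_param_quadratic\<close>). An irrational \<open>w\<close> would thus be quadratic over \<open>\<rat>\<close>, and
  the periodicity condition, a polynomial in \<open>w\<close> over \<open>\<rat>(\<sigma>\<^sub>1, \<sigma>\<^sub>2)\<close> as well, would have to vanish modulo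
  its minimal polynomial. For period three this forces \<open>w \<in> {-2, 0}\<close>. For period four it
  makes half the trace of \<open>w + 2\<close> a rational root of a monic polynomial of degree nine
  over the integers that has no rational root (\<open>no_rational_root\<close>). Geometrically, a double point of the curve
  belongs to a map both of whose critical points have the period in question, and none of
  these double points is rational with conjugate irrational parameters.
\<close>

section \<open>Homogeneous lifts of quadratic rational functions\<close>

text \<open>
  The binary quadratic form \<open>y\<^sup>2 p(x/y)\<close> of a polynomial of degree at most two.
\<close>

definition quad_form :: "qbar poly \<Rightarrow> qbar \<Rightarrow> qbar \<Rightarrow> qbar" where
  "quad_form p x y = coeff p 2 * x^2 + coeff p 1 * (x * y) + coeff p 0 * y^2"

text \<open>
  The pair \<open>(p, q)\<close> may differ from the normalised numerator and denominator by a common constant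
  factor. The absence of a common zero of the two forms on the projective line expresses at once that
  \<open>p\<close> and \<open>q\<close> are coprime and that one of them has degree two; unlike coprimality, it is visibly
  preserved by linear substitutions.
\<close>

definition is_lift :: "ratfun \<Rightarrow> qbar poly \<Rightarrow> qbar poly \<Rightarrow> bool" where
  "is_lift \<phi> p q \<longleftrightarrow> degree p \<le> 2 \<and> degree q \<le> 2 \<and> \<phi> = to_fract p / to_fract q \<and>
     (\<forall>x y. quad_form p x y = 0 \<and> quad_form q x y = 0 \<longrightarrow> x = 0 \<and> y = 0)"

lemma is_liftD:
  assumes "is_lift \<phi> p q"
  shows "degree p \<le> 2" "degree q \<le> 2" "\<phi> = to_fract p / to_fract q"
    "quad_form p x y = 0 \<Longrightarrow> quad_form q x y = 0 \<Longrightarrow> x = 0 \<and> y = 0"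
  using assms unfolding is_lift_def by blast+

lemma degree_le_2_eq:
  fixes p :: "'a::comm_semiring_1 poly"
  assumes "degree p \<le> 2"
  shows "p = [:coeff p 0, coeff p 1, coeff p 2:]"
proof (rule poly_eqI)
  fix n :: nat
  have "coeff p (Suc (Suc (Suc m))) = 0" for m
    using assms by (intro coeff_eq_0) simp
  thus "coeff p n = coeff [:coeff p 0, coeff p 1, coeff p 2:] n"
    by (simp add: coeff_pCons eval_nat_numeral split: nat.splits)
qed

lemma degree_quadratic_le: "degree [:a, b, c:] \<le> 2"
  by (rule order.trans[OF degree_pCons_le]) (simp add: order.trans[OF degree_pCons_le])

lemma poly_degree_le_2:
  fixes p :: "'a::comm_semiring_1 poly"
  assumes "degree p \<le> 2"
  shows "poly p x = coeff p 0 + coeff p 1 * x + coeff p 2 * x^2"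
  by (subst degree_le_2_eq[OF assms]) (simp add: algebra_simps power2_eq_square)

lemma quad_form_dehomogenize:
  assumes "degree p \<le> 2"
  shows "quad_form p x 1 = poly p x"
    and "y \<noteq> 0 \<Longrightarrow> quad_form p x y = y^2 * poly p (x / y)"
proof -
  show "quad_form p x 1 = poly p x"
    by (simp add: quad_form_def poly_degree_le_2[OF assms])
  show "quad_form p x y = y^2 * poly p (x / y)" if "y \<noteq> 0"
    using that by (simp add: quad_form_def poly_degree_le_2[OF assms] power2_eq_square
        distrib_left)
qed

lemma quad_form_has_zero:
  assumes "degree p \<le> 2"
  shows "\<exists>x y. quad_form p x y = 0 \<and> \<not> (x = 0 \<and> y = 0)"
proof (cases "coeff p 2 = 0")
  case True
  hence "quad_form p 1 0 = 0"
    by (simp add: quad_form_def)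
  thus ?thesis by (metis zero_neq_one)
next
  case False
  hence "degree p > 0"
    using le_degree[OF False] by simp
  then obtain r where "poly p r = 0"
    using alg_closed_imp_poly_has_root by blast
  hence "quad_form p r 1 = 0"
    using quad_form_dehomogenize(1)[OF assms] by simp
  thus ?thesis by (metis zero_neq_one)
qed

lemma quad_form_smult: "quad_form (smult c p) x y = c * quad_form p x y"
  by (simp add: quad_form_def algebra_simps)

lemma is_lift_nonzero:
  assumes "is_lift \<phi> p q"
  shows "p \<noteq> 0" "q \<noteq> 0"
proof -
  have z: "quad_form 0 x y = 0" for x y
    by (simp add: quad_form_def)
  obtain x y where p: "quad_form p x y = 0" "\<not> (x = 0 \<and> y = 0)"
    using quad_form_has_zero[OF is_liftD(1)[OF assms]] by blast
  obtain x' y' where q: "quad_form q x' y' = 0" "\<not> (x' = 0 \<and> y' = 0)"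
    using quad_form_has_zero[OF is_liftD(2)[OF assms]] by blast
  show "p \<noteq> 0"
    using is_liftD(4)[OF assms _ q(1)] q(2) z by auto
  show "q \<noteq> 0"
    using is_liftD(4)[OF assms p(1)] p(2) z by auto
qed

lemma rf_num_den:
  shows "rf_den \<phi> \<noteq> 0" "coprime (rf_num \<phi>) (rf_den \<phi>)"
    "\<phi> = to_fract (rf_num \<phi>) / to_fract (rf_den \<phi>)"
proof -
  have "Fract (rf_num \<phi>) (rf_den \<phi>) = \<phi>"
    by (simp add: rf_num_def rf_den_def)
  thus "\<phi> = to_fract (rf_num \<phi>) / to_fract (rf_den \<phi>)"
    by (metis Fract_conv_to_fract)
qed (simp_all add: rf_num_def rf_den_def coprime_quot_of_fract)

lemma common_factor_lowest_terms:
  assumes "\<phi> = to_fract p / to_fract q" "q \<noteq> 0"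
  shows "\<exists>h. h \<noteq> 0 \<and> p = rf_num \<phi> * h \<and> q = rf_den \<phi> * h"
proof -
  have "to_fract p / to_fract q = to_fract (rf_num \<phi>) / to_fract (rf_den \<phi>)"
    using assms rf_num_den by metis
  hence "to_fract (p * rf_den \<phi>) = to_fract (q * rf_num \<phi>)"
    using assms(2) rf_num_den(1)[of \<phi>] by (simp add: field_simps)
  hence eq: "p * rf_den \<phi> = q * rf_num \<phi>"
    by (simp only: to_fract_eq_iff)
  hence "rf_den \<phi> dvd q * rf_num \<phi>"
    by (metis dvd_triv_right)
  hence "rf_den \<phi> dvd q"
    using rf_num_den(2)[of \<phi>] by (simp add: coprime_dvd_mult_left_iff coprime_commute)
  then obtain h where h: "q = rf_den \<phi> * h" by (elim dvdE)
  have "rf_den \<phi> * p = rf_den \<phi> * (rf_num \<phi> * h)"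
    using eq h by (simp add: algebra_simps)
  hence "p = rf_num \<phi> * h"
    using rf_num_den(1)[of \<phi>] by (metis mult_cancel_left)
  thus ?thesis
    using h assms(2) by auto
qed

text \<open>
  A non-constant common factor of \<open>p\<close> and \<open>q\<close> would have a root over the algebraically closed field,
  hence give a common zero of the two forms.
\<close>

lemma is_lift_lowest_terms:
  assumes "is_lift \<phi> p q"
  obtains c where "c \<noteq> 0" "rf_num \<phi> = smult c p" "rf_den \<phi> = smult c q"
proof -
  note l = is_liftD[OF assms]
  obtain h where h: "h \<noteq> 0" "p = rf_num \<phi> * h" "q = rf_den \<phi> * h"
    using common_factor_lowest_terms[OF l(3) is_lift_nonzero(2)[OF assms]] by blast
  have "degree h = 0"
  proof (rule ccontr)
    assume "degree h \<noteq> 0"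
    then obtain r where "poly h r = 0"
      using alg_closed_imp_poly_has_root by blast
    hence "poly p r = 0" "poly q r = 0"
      by (simp_all add: h(2,3))
    hence "quad_form p r 1 = 0" "quad_form q r 1 = 0"
      by (simp_all only: quad_form_dehomogenize(1)[OF l(1)] quad_form_dehomogenize(1)[OF l(2)])
    from l(4)[OF this] show False by simp
  qed
  then obtain k where k: "h = [:k:]" by (rule degree_eq_zeroE)
  have "k \<noteq> 0" using k h(1) by simp
  moreover have "rf_num \<phi> = smult (inverse k) p"  "rf_den \<phi> = smult (inverse k) q"
    using \<open>k \<noteq> 0\<close> by (simp_all add: h(2,3) k)
  ultimately show ?thesis using that[of "inverse k"] by simp
qed

text \<open>
  Once the degree of the map is known to be two, any representation by polynomials of degree at most
  two is automatically in lowest terms. This spares a coprimality check after each conjugation.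
\<close>

lemma is_lift_if_degree_2:
  assumes "rf_degree \<phi> = 2" "\<phi> = to_fract p / to_fract q" "degree p \<le> 2" "degree q \<le> 2"
  shows "is_lift \<phi> p q"
proof -
  have "q \<noteq> 0"
  proof
    assume "q = 0"
    hence "\<phi> = 0" using assms(2) by simp
    thus False using assms(1) by (simp add: rf_degree_def rf_num_def rf_den_def)
  qed
  then obtain h where h: "h \<noteq> 0" "p = rf_num \<phi> * h" "q = rf_den \<phi> * h"
    using common_factor_lowest_terms assms(2) by metis
  have "degree h = 0"
  proof (cases "degree (rf_num \<phi>) = 2")
    case True
    hence "rf_num \<phi> \<noteq> 0" by auto
    thus ?thesis using h assms(3) True by (simp add: degree_mult_eq)
  next
    case False
    hence "degree (rf_den \<phi>) = 2"
      using assms(1) by (simp add: rf_degree_def max_def split: if_splits)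
    thus ?thesis using h assms(4) rf_num_den(1)[of \<phi>] by (simp add: degree_mult_eq)
  qed
  then obtain k where k: "h = [:k:]" by (rule degree_eq_zeroE)
  have k0: "k \<noteq> 0" using k h(1) by simp
  have pq: "p = smult k (rf_num \<phi>)" "q = smult k (rf_den \<phi>)"
    using h k by simp_all
  have deg: "degree (rf_num \<phi>) \<le> 2" "degree (rf_den \<phi>) \<le> 2"
    using assms(1) by (simp_all add: rf_degree_def)
  have "x = 0 \<and> y = 0" if xy: "quad_form p x y = 0" "quad_form q x y = 0" for x y
  proof (cases "y = 0")
    case True
    have "x = 0"
    proof (rule ccontr)
      assume "x \<noteq> 0"
      hence "coeff (rf_num \<phi>) 2 = 0" "coeff (rf_den \<phi>) 2 = 0"
        using xy k0 True by (simp_all add: quad_form_def pq)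
      moreover have "degree (rf_num \<phi>) = 2 \<or> degree (rf_den \<phi>) = 2"
        using assms(1) by (auto simp: rf_degree_def max_def split: if_splits)
      ultimately show False
        by (metis degree_0 leading_coeff_0_iff zero_neq_numeral)
    qed
    thus ?thesis using True by simp
  next
    case False
    have "poly (rf_num \<phi>) (x / y) = 0" "poly (rf_den \<phi>) (x / y) = 0"
      using xy k0 False deg by (simp_all add: pq quad_form_smult quad_form_dehomogenize(2))
    hence "[:- (x / y), 1:] dvd rf_num \<phi>" "[:- (x / y), 1:] dvd rf_den \<phi>"
      by (simp_all add: poly_eq_0_iff_dvd)
    hence "is_unit [:- (x / y), 1:]"
      using rf_num_den(2)[of \<phi>] by (meson coprime_common_divisor)
    hence False
      by (simp add: is_unit_poly_iff)
    thus ?thesis ..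
  qed
  thus ?thesis using assms(2-4) unfolding is_lift_def by blast
qed

lemma is_lift_degree:
  assumes "is_lift \<phi> p q"
  shows "rf_degree \<phi> = 2"
proof -
  obtain c where c: "c \<noteq> 0" "rf_num \<phi> = smult c p" "rf_den \<phi> = smult c q"
    using is_lift_lowest_terms[OF assms] .
  have "coeff p 2 \<noteq> 0 \<or> coeff q 2 \<noteq> 0"
    using is_liftD(4)[OF assms, of 1 0] by (auto simp: quad_form_def)
  hence "degree p = 2 \<or> degree q = 2"
    using is_liftD(1,2)[OF assms] le_degree by (metis le_antisym)
  thus ?thesis
    using c is_liftD(1,2)[OF assms] by (auto simp: rf_degree_def max_def)
qed

lemma is_lift_exists:
  assumes "rf_degree \<phi> = 2"
  obtains p q where "is_lift \<phi> p q"
proof -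
  have "is_lift \<phi> (rf_num \<phi>) (rf_den \<phi>)"
    using assms by (intro is_lift_if_degree_2 rf_num_den(3)) (simp_all add: rf_degree_def)
  thus ?thesis by (rule that)
qed

text \<open>
  The form of \<open>p\<close> evaluated at a pair of polynomials, i.e. the numerator of \<open>p(u/w)\<close> over the
  denominator \<open>w\<^sup>2\<close>.
\<close>

definition quad_subst :: "qbar poly \<Rightarrow> qbar poly \<Rightarrow> qbar poly \<Rightarrow> qbar poly" where
  "quad_subst p u w =
     smult (coeff p 2) (u^2) + smult (coeff p 1) (u * w) + smult (coeff p 0) (w^2)"

lemma to_fract_smult: "to_fract (smult c p) = rf_const c * to_fract p"
  by (simp add: rf_const_def flip: to_fract_mult)

lemma rf_const_simps [simp]:
  "rf_const 0 = 0" "rf_const 1 = 1"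
  by (simp_all add: rf_const_def flip: one_pCons)

lemma poly_rf_const_deg_2:
  assumes "degree p \<le> 2" "w \<noteq> 0"
  shows "poly (map_poly rf_const p) (to_fract u / to_fract w) =
           to_fract (quad_subst p u w) / to_fract w ^ 2"
proof -
  have "degree (map_poly rf_const p) \<le> 2"
    using map_poly_degree_leq[of rf_const p] assms(1) by linarith
  thus ?thesis
    using assms(2)
    by (simp add: poly_degree_le_2 coeff_map_poly quad_subst_def to_fract_smult
          field_simps power2_eq_square)
qed

text \<open>
  The common denominator \<open>w\<^sup>2\<close> cancels. The equation also holds when the new denominator
  vanishes, as both sides are then \<open>0\<close>.
\<close>

lemma rf_comp_lift:
  assumes "is_lift \<phi> p q" "w \<noteq> 0"
  shows "rf_comp \<phi> (to_fract u / to_fract w) =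
           to_fract (quad_subst p u w) / to_fract (quad_subst q u w)"
proof -
  obtain c where c: "c \<noteq> 0" "rf_num \<phi> = smult c p" "rf_den \<phi> = smult c q"
    using is_lift_lowest_terms[OF assms(1)] .
  have deg: "degree (smult c p) \<le> 2" "degree (smult c q) \<le> 2"
    using is_liftD(1,2)[OF assms(1)] c(1) by simp_all
  have s: "quad_subst (smult c r) u w = smult c (quad_subst r u w)" for r
    by (simp add: quad_subst_def smult_add_right)
  have "rf_const c \<noteq> 0"
    using c(1) by (simp add: rf_const_def)
  thus ?thesis
    using assms(2) by (simp add: rf_comp_def c(2,3) poly_rf_const_deg_2[OF deg(1)]
        poly_rf_const_deg_2[OF deg(2)] s to_fract_smult)
qed

lemma rf_comp_linear:
  assumes "degree (rf_num \<tau>) \<le> 1" "degree (rf_den \<tau>) \<le> 1" "w \<noteq> 0"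
  shows "rf_comp \<tau> (to_fract u / to_fract w) =
           to_fract (smult (coeff (rf_num \<tau>) 1) u + smult (coeff (rf_num \<tau>) 0) w) /
           to_fract (smult (coeff (rf_den \<tau>) 1) u + smult (coeff (rf_den \<tau>) 0) w)"
proof -
  have *: "poly (map_poly rf_const p) (to_fract u / to_fract w) =
          to_fract (smult (coeff p 1) u + smult (coeff p 0) w) / to_fract w"
    if "degree p \<le> 1" for p
  proof -
    have "degree p \<le> 2" "coeff p 2 = 0"
      using that by (auto intro: coeff_eq_0)
    thus ?thesis
      using assms(3) by (simp add: poly_rf_const_deg_2 quad_subst_def power2_eq_square
          smult_add_right to_fract_smult field_simps)
  qed
  show ?thesis
    using assms(3) by (simp add: rf_comp_def *[OF assms(1)] *[OF assms(2)])
qed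

section \<open>Fixed points, multipliers and critical points on a lift\<close>

definition proj_point :: "qbar \<times> qbar \<Rightarrow> P1" where
  "proj_point v = (if snd v = 0 then Infty else Fin (fst v / snd v))"

text \<open>
  The determinant of two vectors, which vanishes iff they span the same line.
\<close>

definition cross :: "qbar \<times> qbar \<Rightarrow> qbar \<times> qbar \<Rightarrow> qbar" where
  "cross v w = fst v * snd w - snd v * fst w"

definition lift_map :: "qbar poly \<Rightarrow> qbar poly \<Rightarrow> qbar \<times> qbar \<Rightarrow> qbar \<times> qbar" where
  "lift_map p q v = (quad_form p (fst v) (snd v), quad_form q (fst v) (snd v))"

text \<open>
  The cubic form \<open>y P - x Q\<close>, which vanishes exactly on the eigenlines of the lift.
\<close>

definition fixed_form :: "qbar poly \<Rightarrow> qbar poly \<Rightarrow> qbar \<times> qbar \<Rightarrow> qbar" where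
  "fixed_form p q v = cross (lift_map p q v) v"

text \<open>
  The trace of the Jacobian matrix of the lift, a linear form in \<open>v\<close>.
\<close>

definition jacobian_trace :: "qbar poly \<Rightarrow> qbar poly \<Rightarrow> qbar \<times> qbar \<Rightarrow> qbar" where
  "jacobian_trace p q v =
     (2 * coeff p 2 + coeff q 1) * fst v + (coeff p 1 + 2 * coeff q 0) * snd v"

definition eigenvalue :: "qbar poly \<Rightarrow> qbar poly \<Rightarrow> qbar \<times> qbar \<Rightarrow> qbar" where
  "eigenvalue p q v = (if snd v = 0 then fst (lift_map p q v) / fst v
                       else snd (lift_map p q v) / snd v)"

text \<open>
  By Euler's identity \<open>D\<Phi>(v) v = 2\<Phi>(v) = 2\<lambda>v\<close>, and \<open>D\<Phi>(v)\<close> acts on the quotient by the line of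
  \<open>v\<close> as \<open>\<lambda>\<close> times the multiplier; so the trace divided by \<open>\<lambda>\<close> is \<open>2\<close> plus the multiplier.
\<close>

definition lift_multiplier :: "qbar poly \<Rightarrow> qbar poly \<Rightarrow> qbar \<times> qbar \<Rightarrow> qbar" where
  "lift_multiplier p q v = jacobian_trace p q v / eigenvalue p q v - 2"

text \<open>
  Half the determinant of \<open>D\<Phi>(v)\<close>; at \<open>v = (x, 1)\<close> it is \<open>p' q - p q'\<close>.
\<close>

definition wronskian :: "qbar poly \<Rightarrow> qbar poly \<Rightarrow> qbar \<times> qbar \<Rightarrow> qbar" where
  "wronskian p q v =
     (coeff p 2 * coeff q 1 - coeff p 1 * coeff q 2) * (fst v)\<^sup>2
     + 2 * (coeff p 2 * coeff q 0 - coeff p 0 * coeff q 2) * (fst v * snd v)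
     + (coeff p 1 * coeff q 0 - coeff p 0 * coeff q 1) * (snd v)\<^sup>2"

text \<open>
  Splitting the cubic into three linear forms lists the fixed points with multiplicity, without
  treating the point at infinity separately. A leading constant is absorbed into the vectors.
\<close>

definition fixed_split ::
  "qbar poly \<Rightarrow> qbar poly \<Rightarrow> qbar \<times> qbar \<Rightarrow> qbar \<times> qbar \<Rightarrow> qbar \<times> qbar \<Rightarrow> bool" where
  "fixed_split p q v1 v2 v3 \<longleftrightarrow> v1 \<noteq> (0, 0) \<and> v2 \<noteq> (0, 0) \<and> v3 \<noteq> (0, 0) \<and>
     (\<forall>v. fixed_form p q v = cross v v1 * cross v v2 * cross v v3)"

text \<open>
  The coordinate change \<open>1/x\<close> swaps the variables of the form.
\<close>

definition reverse_quad :: "qbar poly \<Rightarrow> qbar poly" where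
  "reverse_quad p = [:coeff p 2, coeff p 1, coeff p 0:]"

lemma coeff_reverse_quad [simp]:
  "coeff (reverse_quad p) 0 = coeff p 2" "coeff (reverse_quad p) 1 = coeff p 1"
  "coeff (reverse_quad p) (Suc 0) = coeff p 1"
  "coeff (reverse_quad p) 2 = coeff p 0"
  by (simp_all add: reverse_quad_def numeral_2_eq_2)

lemma quad_form_reverse: "quad_form (reverse_quad p) x y = quad_form p y x"
  by (simp add: quad_form_def algebra_simps)

lemma degree_reverse_quad: "degree (reverse_quad p) \<le> 2"
  unfolding reverse_quad_def by (rule degree_quadratic_le)

lemma proj_point_eq_iff:
  assumes "v \<noteq> (0, 0)" "w \<noteq> (0, 0)"
  shows "proj_point v = proj_point w \<longleftrightarrow> cross v w = 0"
proof (cases "snd v = 0"; cases "snd w = 0")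
  assume "snd v \<noteq> 0" "snd w \<noteq> 0"
  thus ?thesis
    by (simp add: proj_point_def cross_def frac_eq_eq mult.commute)
qed (use assms in \<open>auto simp: proj_point_def cross_def prod_eq_iff\<close>)

lemma proj_point_surj:
  obtains v where "v \<noteq> (0, 0)" "P = proj_point v"
proof (cases P)
  case (Fin a)
  thus ?thesis using that[of "(a, 1)"] by (simp add: proj_point_def)
next
  case Infty
  thus ?thesis using that[of "(1, 0)"] by (simp add: proj_point_def)
qed

lemma lift_map_nonzero:
  assumes "is_lift \<phi> p q" "v \<noteq> (0, 0)"
  shows "lift_map p q v \<noteq> (0, 0)"
proof
  assume "lift_map p q v = (0, 0)"
  hence "quad_form p (fst v) (snd v) = 0" "quad_form q (fst v) (snd v) = 0"
    by (simp_all add: lift_map_def)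
  from is_liftD(4)[OF assms(1) this] show False
    using assms(2) by (simp add: prod_eq_iff)
qed

lemma lift_map_scale:
  "lift_map p q (k * x, k * y) = (k^2 * fst (lift_map p q (x, y)), k^2 * snd (lift_map p q (x, y)))"
  by (simp add: lift_map_def quad_form_def power2_eq_square algebra_simps)

lemma proj_point_scale: "k \<noteq> 0 \<Longrightarrow> proj_point (k * x, k * y) = proj_point (x, y)"
  by (simp add: proj_point_def)

lemma is_lift_inverse:
  assumes "is_lift \<phi> p q"
  shows "is_lift (inverse \<phi>) q p"
proof -
  have "inverse \<phi> = to_fract q / to_fract p"
    by (simp add: is_liftD(3)[OF assms])
  thus ?thesis
    using is_liftD(1,2,4)[OF assms] unfolding is_lift_def by blast
qed

lemma inverse_rf_X: "inverse rf_X = to_fract 1 / to_fract [:0, 1:]"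
  by (simp add: rf_X_def field_simps)

lemma is_lift_comp_inverse_X:
  assumes "is_lift \<phi> p q"
  shows "is_lift (rf_comp \<phi> (inverse rf_X)) (reverse_quad p) (reverse_quad q)"
proof -
  have s: "quad_subst r 1 [:0, 1:] = reverse_quad r" for r
    by (simp add: quad_subst_def reverse_quad_def power2_eq_square)
  have "rf_comp \<phi> (inverse rf_X) = to_fract (reverse_quad p) / to_fract (reverse_quad q)"
    unfolding inverse_rf_X by (subst rf_comp_lift[OF assms]) (simp_all add: s)
  moreover have "x = 0 \<and> y = 0"
    if "quad_form (reverse_quad p) x y = 0" "quad_form (reverse_quad q) x y = 0" for x y
    using is_liftD(4)[OF assms, of y x] that unfolding quad_form_reverse by blast
  ultimately show ?thesis
    unfolding is_lift_def using degree_reverse_quad by blast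
qed

lemma is_lift_flip:
  assumes "is_lift \<phi> p q"
  shows "is_lift (rf_flip \<phi>) (reverse_quad q) (reverse_quad p)"
  unfolding rf_flip_def using assms by (intro is_lift_inverse is_lift_comp_inverse_X)

lemma rf_eval_fin_lift:
  assumes "is_lift \<phi> p q"
  shows "rf_eval_fin \<phi> a = proj_point (lift_map p q (a, 1))"
proof -
  note l = is_liftD[OF assms]
  obtain c where "c \<noteq> 0" "rf_num \<phi> = smult c p" "rf_den \<phi> = smult c q"
    using is_lift_lowest_terms[OF assms] .
  thus ?thesis
    by (simp add: rf_eval_fin_def proj_point_def lift_map_def
        quad_form_dehomogenize(1)[OF l(1)] quad_form_dehomogenize(1)[OF l(2)])
qed

lemma proj_point_cases:
  assumes "v \<noteq> (0, 0)"
  obtains (Fin) k a where "k \<noteq> 0" "v = (k * a, k * 1)" "proj_point v = Fin a"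
  | (Infty) k where "k \<noteq> 0" "v = (k * 1, k * 0)" "proj_point v = Infty"
proof (cases "snd v = 0")
  case True
  thus ?thesis using assms that(2)[of "fst v"] by (simp add: prod_eq_iff proj_point_def)
next
  case False
  thus ?thesis using assms that(1)[of "snd v" "fst v / snd v"]
    by (simp add: prod_eq_iff proj_point_def)
qed

lemma rf_eval_lift:
  assumes "is_lift \<phi> p q" "v \<noteq> (0, 0)"
  shows "rf_eval \<phi> (proj_point v) = proj_point (lift_map p q v)"
  using assms(2)
proof (cases rule: proj_point_cases)
  case (Fin k a)
  have "rf_eval \<phi> (proj_point v) = proj_point (lift_map p q (a, 1))"
    unfolding Fin(3) by (simp add: rf_eval_def rf_eval_fin_lift[OF assms(1)])
  also have "\<dots> = proj_point (lift_map p q v)"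
    unfolding Fin(2) lift_map_scale using Fin(1) by (simp add: proj_point_scale)
  finally show ?thesis .
next
  case (Infty k)
  have "rf_eval \<phi> (proj_point v) = proj_point (lift_map p q (1, 0))"
    unfolding Infty(3)
    by (simp add: rf_eval_def rf_eval_fin_lift[OF is_lift_comp_inverse_X[OF assms(1)]]
        lift_map_def quad_form_reverse)
  also have "\<dots> = proj_point (lift_map p q v)"
    unfolding Infty(2) lift_map_scale using Infty(1) by (simp add: proj_point_scale)
  finally show ?thesis .
qed

lemma poly_pderiv_deg_2:
  fixes p :: "qbar poly"
  assumes "degree p \<le> 2"
  shows "poly (pderiv p) a = coeff p 1 + 2 * coeff p 2 * a"
  by (subst degree_le_2_eq[OF assms]) (simp add: pderiv_pCons algebra_simps)

lemma rf_deriv_lift: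
  assumes "is_lift \<phi> p q"
  shows "rf_deriv \<phi> a = wronskian p q (a, 1) / (quad_form q a 1)\<^sup>2"
proof -
  note l = is_liftD[OF assms]
  obtain c where c: "c \<noteq> 0" "rf_num \<phi> = smult c p" "rf_den \<phi> = smult c q"
    using is_lift_lowest_terms[OF assms] .
  have "poly (pderiv p * q - p * pderiv q) a = wronskian p q (a, 1)"
    by (simp add: poly_pderiv_deg_2[OF l(1)] poly_pderiv_deg_2[OF l(2)]
        poly_degree_le_2[OF l(1)] poly_degree_le_2[OF l(2)] wronskian_def
        algebra_simps power2_eq_square)
  moreover have "pderiv (smult c p) * smult c q - smult c p * pderiv (smult c q)
      = smult (c^2) (pderiv p * q - p * pderiv q)"
    by (simp add: pderiv_smult power2_eq_square smult_diff_right)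
  ultimately have "rf_deriv \<phi> a = c^2 * wronskian p q (a, 1) / (c * poly q a)^2"
    by (simp only: rf_deriv_def c(2,3) poly_smult)
  thus ?thesis
    using c(1) by (simp add: quad_form_dehomogenize(1)[OF l(2)] power_mult_distrib)
qed

lemma critical_fin_lift:
  assumes "is_lift \<phi> p q"
  shows "critical_fin \<phi> a \<longleftrightarrow> wronskian p q (a, 1) = 0"
proof (cases "quad_form q a 1 = 0")
  case True
  hence p: "quad_form p a 1 \<noteq> 0"
    using is_liftD(4)[OF assms] by (metis one_neq_zero)
  have "rf_eval_fin \<phi> a = Infty"
    using True by (simp add: rf_eval_fin_lift[OF assms] proj_point_def lift_map_def)
  moreover have "wronskian q p (a, 1) = - wronskian p q (a, 1)"
    by (simp add: wronskian_def algebra_simps)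
  ultimately show ?thesis
    using p by (simp add: critical_fin_def rf_deriv_lift[OF is_lift_inverse[OF assms]])
next
  case False
  hence "rf_eval_fin \<phi> a \<noteq> Infty"
    by (simp add: rf_eval_fin_lift[OF assms] proj_point_def lift_map_def)
  thus ?thesis
    using False by (simp add: critical_fin_def rf_deriv_lift[OF assms])
qed

lemma wronskian_scale: "wronskian p q (k * x, k * y) = k^2 * wronskian p q (x, y)"
  by (simp add: wronskian_def algebra_simps power2_eq_square)

lemma critical_point_lift:
  assumes "is_lift \<phi> p q" "v \<noteq> (0, 0)"
  shows "critical_point \<phi> (proj_point v) \<longleftrightarrow> wronskian p q v = 0"
  using assms(2)
proof (cases rule: proj_point_cases)
  case (Fin k a)
  have "critical_point \<phi> (proj_point v) \<longleftrightarrow> wronskian p q (a, 1) = 0"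
    unfolding Fin(3) by (simp add: critical_point_def critical_fin_lift[OF assms(1)])
  thus ?thesis
    unfolding Fin(2) wronskian_scale using Fin(1) by simp
next
  case (Infty k)
  have "wronskian (reverse_quad p) (reverse_quad q) (0, 1) = - wronskian p q (1, 0)"
    by (simp add: wronskian_def algebra_simps)
  hence "critical_point \<phi> (proj_point v) \<longleftrightarrow> wronskian p q (1, 0) = 0"
    unfolding Infty(3)
    by (simp add: critical_point_def critical_fin_lift[OF is_lift_comp_inverse_X[OF assms(1)]])
  thus ?thesis
    unfolding Infty(2) wronskian_scale using Infty(1) by simp
qed

lemma eigenvalue:
  assumes "is_lift \<phi> p q" "v \<noteq> (0, 0)" "fixed_form p q v = 0"
  shows "lift_map p q v = (eigenvalue p q v * fst v, eigenvalue p q v * snd v)"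
    and "eigenvalue p q v \<noteq> 0"
proof -
  show *: "lift_map p q v = (eigenvalue p q v * fst v, eigenvalue p q v * snd v)"
    using assms(2,3)
    by (auto simp: prod_eq_iff eigenvalue_def fixed_form_def cross_def field_simps)
  show "eigenvalue p q v \<noteq> 0"
    using lift_map_nonzero[OF assms(1,2)] unfolding * by auto
qed

lemma lift_multiplier_eq:
  assumes "lift_map p q v = (l * fst v, l * snd v)" "v \<noteq> (0, 0)"
  shows "lift_multiplier p q v = jacobian_trace p q v / l - 2"
proof -
  have "eigenvalue p q v = l"
    using assms by (auto simp: eigenvalue_def prod_eq_iff)
  thus ?thesis by (simp add: lift_multiplier_def)
qed

text \<open>
  At a fixed point \<open>p = a q\<close>, so the quotient rule gives \<open>(p' - a q') / q\<close>; Euler's identity for \<open>Q\<close>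
  turns the numerator into the trace minus \<open>2q\<close>.
\<close>

lemma rf_deriv_fixed:
  assumes "is_lift \<phi> p q" "fixed_form p q (a, 1) = 0"
  shows "rf_deriv \<phi> a = lift_multiplier p q (a, 1)"
proof -
  define l where "l = quad_form q a 1"
  have e: "quad_form p a 1 = a * l"
    using assms(2) by (simp add: fixed_form_def cross_def lift_map_def l_def)
  have l0: "l \<noteq> 0"
    using is_liftD(4)[OF assms(1)] e unfolding l_def by (metis mult_zero_right one_neq_zero)
  have m: "lift_multiplier p q (a, 1) = jacobian_trace p q (a, 1) / l - 2"
    using e by (intro lift_multiplier_eq) (simp_all add: lift_map_def l_def)
  have "wronskian p q (a, 1)
      = (coeff p 1 + 2 * coeff p 2 * a) * quad_form q a 1
        - quad_form p a 1 * (coeff q 1 + 2 * coeff q 2 * a)"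
    by (simp add: wronskian_def quad_form_def algebra_simps power2_eq_square)
  also have "\<dots> = l * (coeff p 1 + 2 * coeff p 2 * a - a * (coeff q 1 + 2 * coeff q 2 * a))"
    unfolding e by (simp add: l_def algebra_simps)
  also have "\<dots> = l * (jacobian_trace p q (a, 1) - 2 * l)"
    by (simp add: jacobian_trace_def l_def quad_form_def algebra_simps power2_eq_square)
  finally show ?thesis
    unfolding rf_deriv_lift[OF assms(1)] m l_def[symmetric]
    using l0 by (simp add: field_simps power2_eq_square)
qed

lemma fixed_form_reverse:
  "fixed_form (reverse_quad q) (reverse_quad p) (x, y) = - fixed_form p q (y, x)"
  by (simp add: fixed_form_def cross_def lift_map_def quad_form_reverse)

lemma fixed_form_scale: "fixed_form p q (k * x, k * y) = k^3 * fixed_form p q (x, y)"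
  by (simp add: fixed_form_def cross_def lift_map_scale algebra_simps power2_eq_square power3_eq_cube)

lemma lift_multiplier_scale:
  assumes "k \<noteq> 0"
  shows "lift_multiplier p q (k * x, k * y) = lift_multiplier p q (x, y)"
proof -
  have "eigenvalue p q (k * x, k * y) = k * eigenvalue p q (x, y)"
    unfolding eigenvalue_def lift_map_scale using assms by (simp add: power2_eq_square)
  moreover have "jacobian_trace p q (k * x, k * y) = k * jacobian_trace p q (x, y)"
    by (simp add: jacobian_trace_def algebra_simps)
  ultimately show ?thesis
    using assms by (simp add: lift_multiplier_def)
qed

text \<open>
  The formula by trace and eigenvalue covers the fixed point at infinity too, since it is symmetric in
  the two coordinates.
\<close>

lemma multiplier_lift:
  assumes "is_lift \<phi> p q" "v \<noteq> (0, 0)" "fixed_form p q v = 0"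
  shows "multiplier \<phi> (proj_point v) = lift_multiplier p q v"
  using assms(2)
proof (cases rule: proj_point_cases)
  case (Fin k a)
  have "fixed_form p q (a, 1) = 0"
    using assms(3) Fin(1) unfolding Fin(2) fixed_form_scale by simp
  thus ?thesis
    unfolding Fin(3) unfolding Fin(2) lift_multiplier_scale[OF Fin(1)]
    by (simp add: multiplier_def rf_deriv_fixed[OF assms(1)])
next
  case (Infty k)
  have f: "fixed_form p q (1, 0) = 0"
    using assms(3) Infty(1) unfolding Infty(2) fixed_form_scale by simp
  hence "rf_deriv (rf_flip \<phi>) 0 = lift_multiplier (reverse_quad q) (reverse_quad p) (0, 1)"
    by (intro rf_deriv_fixed is_lift_flip assms(1)) (simp add: fixed_form_reverse)
  also have "\<dots> = lift_multiplier p q (1, 0)"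
    by (simp add: lift_multiplier_def eigenvalue_def jacobian_trace_def lift_map_def
        quad_form_reverse)
  finally show ?thesis
    unfolding Infty(3) unfolding Infty(2) lift_multiplier_scale[OF Infty(1)]
    by (simp add: multiplier_def)
qed

section \<open>Symmetric functions of the multipliers\<close>

definition linear_factor :: "qbar \<times> qbar \<Rightarrow> qbar poly" where
  "linear_factor v = [:- fst v, snd v:]"

lemma order_linear_factor:
  assumes "v \<noteq> (0, 0)"
  shows "order a (linear_factor v) = of_bool (proj_point v = Fin a)"
  using assms
proof (cases rule: proj_point_cases)
  case (Fin k b)
  have l: "linear_factor v = smult k [:- b, 1:]"
    by (simp add: linear_factor_def Fin(2))
  show ?thesis
  proof (cases "a = b")
    case True
    have "order a ([:- a, 1:] ^ 1) = 1" by (rule order_power_n_n)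
    thus ?thesis using True Fin(1,3) by (simp add: l order_smult del: smult_pCons)
  next
    case False
    hence "poly (linear_factor v) a \<noteq> 0"
      using Fin(1) by (simp add: l right_diff_distrib[symmetric])
    thus ?thesis using False Fin(3) by (simp add: order_0I)
  qed
next
  case (Infty k)
  hence "poly (linear_factor v) a \<noteq> 0"
    by (simp add: linear_factor_def)
  thus ?thesis using Infty(3) by (simp add: order_0I)
qed

lemma fixed_splitD:
  assumes "fixed_split p q v1 v2 v3"
  shows "v1 \<noteq> (0, 0)" "v2 \<noteq> (0, 0)" "v3 \<noteq> (0, 0)"
    "fixed_form p q v = cross v v1 * cross v v2 * cross v v3"
  using assms unfolding fixed_split_def by blast+

text \<open>
  Setting \<open>y = 1\<close> in the splitting of the cubic factors \<open>p - x q\<close> into linear factors; a factor for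
  the point at infinity becomes constant.
\<close>

lemma fixed_order_fin_split:
  assumes "is_lift \<phi> p q" "fixed_split p q v1 v2 v3"
  shows "fixed_order_fin \<phi> a = of_bool (proj_point v1 = Fin a) + of_bool (proj_point v2 = Fin a)
           + of_bool (proj_point v3 = Fin a)"
proof -
  note l = is_liftD[OF assms(1)] and s = fixed_splitD[OF assms(2)]
  obtain c where c: "c \<noteq> 0" "rf_num \<phi> = smult c p" "rf_den \<phi> = smult c q"
    using is_lift_lowest_terms[OF assms(1)] .
  have nz: "linear_factor v \<noteq> 0" if "v \<noteq> (0, 0)" for v
    using that by (auto simp: linear_factor_def prod_eq_iff)
  have "poly (p - [:0, 1:] * q) x
      = poly (linear_factor v1 * linear_factor v2 * linear_factor v3) x" for x
  proof -
    have "poly (p - [:0, 1:] * q) x = fixed_form p q (x, 1)"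
      by (simp add: fixed_form_def cross_def lift_map_def quad_form_dehomogenize(1)[OF l(1)]
          quad_form_dehomogenize(1)[OF l(2)])
    also have "\<dots> = cross (x, 1) v1 * cross (x, 1) v2 * cross (x, 1) v3"
      by (rule s(4))
    also have "\<dots> = poly (linear_factor v1 * linear_factor v2 * linear_factor v3) x"
      by (simp add: cross_def linear_factor_def algebra_simps)
    finally show ?thesis .
  qed
  hence eq: "p - [:0, 1:] * q = linear_factor v1 * linear_factor v2 * linear_factor v3"
    by (simp only: poly_eq_poly_eq_iff[symmetric] fun_eq_iff) blast
  have "fixed_order_fin \<phi> a = order a (smult c (p - [:0, 1:] * q))"
    unfolding fixed_order_fin_def c(2,3) by (simp add: smult_diff_right)
  also have "\<dots> = order a (linear_factor v1) + order a (linear_factor v2)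
      + order a (linear_factor v3)"
    unfolding eq using c(1) nz[OF s(1)] nz[OF s(2)] nz[OF s(3)]
    by (simp add: order_smult order_mult)
  finally show ?thesis
    by (simp only: order_linear_factor[OF s(1)] order_linear_factor[OF s(2)]
        order_linear_factor[OF s(3)])
qed

lemma fixed_split_reverse:
  assumes "fixed_split p q v1 v2 v3"
  shows "fixed_split (reverse_quad q) (reverse_quad p) (prod.swap v1) (prod.swap v2) (prod.swap v3)"
proof -
  note s = fixed_splitD[OF assms]
  have c: "cross (prod.swap v) w = - cross v (prod.swap w)" for v w
    by (simp add: cross_def)
  have "fixed_form (reverse_quad q) (reverse_quad p) v
      = cross v (prod.swap v1) * cross v (prod.swap v2) * cross v (prod.swap v3)" for v
  proof -
    have "fixed_form (reverse_quad q) (reverse_quad p) v = - fixed_form p q (prod.swap v)"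
      by (cases v) (simp add: fixed_form_reverse)
    thus ?thesis by (simp add: s(4) c)
  qed
  moreover have "prod.swap v \<noteq> (0, 0)" if "v \<noteq> (0, 0)" for v :: "qbar \<times> qbar"
    using that by (auto simp: prod_eq_iff)
  ultimately show ?thesis
    unfolding fixed_split_def using s(1-3) by blast
qed

lemma fixed_order_split:
  assumes "is_lift \<phi> p q" "fixed_split p q v1 v2 v3"
  shows "fixed_order \<phi> P = of_bool (proj_point v1 = P) + of_bool (proj_point v2 = P)
           + of_bool (proj_point v3 = P)"
proof (cases P)
  case (Fin a)
  thus ?thesis by (simp add: fixed_order_def fixed_order_fin_split[OF assms])
next
  case Infty
  have "proj_point (prod.swap v) = Fin 0 \<longleftrightarrow> proj_point v = Infty" if "v \<noteq> (0, 0)" for v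
    using that by (auto simp: proj_point_def prod_eq_iff)
  thus ?thesis
    using fixed_splitD(1-3)[OF assms(2)]
    by (simp add: Infty fixed_order_def
        fixed_order_fin_split[OF is_lift_flip[OF assms(1)] fixed_split_reverse[OF assms(2)]])
qed

lemma fixed_points_split:
  assumes "is_lift \<phi> p q" "fixed_split p q v1 v2 v3"
  shows "fixed_points \<phi> = {proj_point v1, proj_point v2, proj_point v3}"
proof -
  note s = fixed_splitD[OF assms(2)]
  have "rf_eval \<phi> P = P \<longleftrightarrow> P \<in> {proj_point v1, proj_point v2, proj_point v3}" for P
  proof -
    obtain v where v: "v \<noteq> (0, 0)" "P = proj_point v" by (rule proj_point_surj)
    have "rf_eval \<phi> P = P \<longleftrightarrow> fixed_form p q v = 0"
      unfolding v(2) rf_eval_lift[OF assms(1) v(1)] fixed_form_def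
      by (rule proj_point_eq_iff[OF lift_map_nonzero[OF assms(1) v(1)] v(1)])
    also have "\<dots> \<longleftrightarrow> P \<in> {proj_point v1, proj_point v2, proj_point v3}"
      unfolding v(2) s(4) insert_iff proj_point_eq_iff[OF v(1) s(1)]
        proj_point_eq_iff[OF v(1) s(2)] proj_point_eq_iff[OF v(1) s(3)] by simp
    finally show ?thesis .
  qed
  thus ?thesis unfolding fixed_points_def by blast
qed

lemma subsets_triple:
  assumes "a \<noteq> b" "a \<noteq> c" "b \<noteq> c"
  shows "{S. S \<subseteq> {a, b, c} \<and> card S = 1} = {{a}, {b}, {c}}"
    and "{S. S \<subseteq> {a, b, c} \<and> card S = 2} = {{a, b}, {a, c}, {b, c}}"
proof -
  show "{S. S \<subseteq> {a, b, c} \<and> card S = 1} = {{a}, {b}, {c}}"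
    by (auto simp: card_1_singleton_iff)
  show "{S. S \<subseteq> {a, b, c} \<and> card S = 2} = {{a, b}, {a, c}, {b, c}}"
  proof (intro equalityI subsetI)
    fix S assume "S \<in> {S. S \<subseteq> {a, b, c} \<and> card S = 2}"
    then obtain x y where "S = {x, y}" "x \<noteq> y" "x \<in> {a, b, c}" "y \<in> {a, b, c}"
      by (auto simp: card_2_iff)
    thus "S \<in> {{a, b}, {a, c}, {b, c}}"
      by (elim insertE emptyE) (simp_all add: insert_commute)
  qed (use assms in auto)
qed

lemma symmetric_sums_triple:
  fixes f :: "'a \<Rightarrow> 'b::comm_semiring_1"
  assumes "a \<noteq> b" "a \<noteq> c" "b \<noteq> c"
  shows "(\<Sum>S \<in> {S. S \<subseteq> {a, b, c} \<and> card S = 1}. prod f S) = f a + f b + f c"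
    and "(\<Sum>S \<in> {S. S \<subseteq> {a, b, c} \<and> card S = 2}. prod f S) = f a * f b + f a * f c + f b * f c"
proof -
  show "(\<Sum>S \<in> {S. S \<subseteq> {a, b, c} \<and> card S = 1}. prod f S) = f a + f b + f c"
    unfolding subsets_triple(1)[OF assms] using assms by (simp add: add.assoc)
  have "{a, b} \<noteq> {a, c}" "{a, b} \<noteq> {b, c}" "{a, c} \<noteq> {b, c}"
    using assms by (auto simp: doubleton_eq_iff)
  thus "(\<Sum>S \<in> {S. S \<subseteq> {a, b, c} \<and> card S = 2}. prod f S) = f a * f b + f a * f c + f b * f c"
    unfolding subsets_triple(2)[OF assms] using assms by (simp add: add.assoc)
qed

text \<open>
  The three indices \<open>(P, k)\<close> over which \<open>mult_sigma\<close> ranges are matched with \<open>v1, v2, v3\<close> by letting \<open>k\<close>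
  count the earlier vectors on the same line.
\<close>

lemma mult_sigma_split:
  assumes "is_lift \<phi> p q" "fixed_split p q v1 v2 v3"
  defines "m \<equiv> lift_multiplier p q"
  shows "mult_sigma 1 \<phi> = m v1 + m v2 + m v3"
    and "mult_sigma 2 \<phi> = m v1 * m v2 + m v1 * m v3 + m v2 * m v3"
proof -
  note s = fixed_splitD[OF assms(2)]
  define P1 P2 P3 where "P1 = proj_point v1" and "P2 = proj_point v2" and "P3 = proj_point v3"
  (* The second components make the indices distinct even if some of the points coincide. *)
  define t1 t2 t3 :: "P1 \<times> nat" where
    "t1 = (P1, 0)" and "t2 = (P2, of_bool (P1 = P2))"
    and "t3 = (P3, of_bool (P1 = P3) + of_bool (P2 = P3))"
  have d: "t1 \<noteq> t2" "t1 \<noteq> t3" "t2 \<noteq> t3"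
    by (auto simp: t1_def t2_def t3_def)
  have order: "fixed_order \<phi> P = of_bool (P1 = P) + of_bool (P2 = P) + of_bool (P3 = P)" for P
    unfolding P1_def P2_def P3_def by (rule fixed_order_split[OF assms(1,2)])
  have pts: "fixed_points \<phi> = {P1, P2, P3}"
    unfolding P1_def P2_def P3_def by (rule fixed_points_split[OF assms(1,2)])
  have X: "fixed_points_with_mult \<phi> = {t1, t2, t3}"
  proof (rule Set.set_eqI)
    fix z :: "P1 \<times> nat"
    obtain P k where z: "z = (P, k)" by (cases z)
    show "z \<in> fixed_points_with_mult \<phi> \<longleftrightarrow> z \<in> {t1, t2, t3}"
      unfolding fixed_points_with_mult_def pts order z t1_def t2_def t3_def
      by (cases "P1 = P2"; cases "P1 = P3"; cases "P2 = P3") (auto simp: less_Suc_eq)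
  qed
  have mult: "multiplier \<phi> (proj_point v) = m v" if "fixed_form p q v = 0" "v \<noteq> (0, 0)" for v
    unfolding m_def by (rule multiplier_lift[OF assms(1) that(2,1)])
  have c: "cross v v = 0" for v by (simp add: cross_def)
  have ms: "multiplier \<phi> P1 = m v1" "multiplier \<phi> P2 = m v2" "multiplier \<phi> P3 = m v3"
    unfolding P1_def P2_def P3_def by (rule mult, simp add: s(4) c, rule s)+
  show "mult_sigma 1 \<phi> = m v1 + m v2 + m v3"
    unfolding mult_sigma_def X symmetric_sums_triple(1)[OF d]
    by (simp add: t1_def t2_def t3_def ms)
  show "mult_sigma 2 \<phi> = m v1 * m v2 + m v1 * m v3 + m v2 * m v3"
    unfolding mult_sigma_def X symmetric_sums_triple(2)[OF d]
    by (simp add: t1_def t2_def t3_def ms)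
qed

text \<open>
  Roots of \<open>f\<close> give the finite lines; each missing degree contributes the line at infinity, whose
  linear form is \<open>y\<close>.
\<close>

lemma cubic_form_splits:
  fixes f :: "qbar poly"
  assumes "f \<noteq> 0" "degree f \<le> 3"
  obtains v1 v2 v3 where "v1 \<noteq> (0, 0)" "v2 \<noteq> (0, 0)" "v3 \<noteq> (0, 0)"
    "\<And>x y. coeff f 3 * x^3 + coeff f 2 * x^2 * y + coeff f 1 * x * y^2 + coeff f 0 * y^3
       = cross (x, y) v1 * cross (x, y) v2 * cross (x, y) v3"
proof -
  obtain A where A: "size A = degree f" "f = smult (lead_coeff f) (\<Prod>x\<in>#A. [:- x, 1:])"
    using alg_closed_imp_factorization[OF assms(1)] by blast
  obtain xs where xs: "mset xs = A" using ex_mset by blast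
  define l where "l = lead_coeff f"
  have l: "l \<noteq> 0" using assms(1) by (simp add: l_def)
  have f: "f = smult l (\<Prod>x\<leftarrow>xs. [:- x, 1:])"
    using A(2) unfolding xs[symmetric] l_def[symmetric] by (simp flip: prod_mset_prod_list)
  have len: "length xs \<le> 3"
    using A(1) assms(2) xs by auto
  consider "xs = []" | a where "xs = [a]" | a b where "xs = [a, b]" | a b c where "xs = [a, b, c]"
    using len by (auto simp: le_Suc_eq length_Suc_conv numeral_3_eq_3)
  thus ?thesis
  proof cases
    case 1
    show ?thesis
      by (rule that[of "(- l, 0)" "(- 1, 0)" "(- 1, 0)"])
         (use l in \<open>simp_all add: f 1 cross_def eval_nat_numeral\<close>)
  next
    case (2 a)
    show ?thesis
      by (rule that[of "(l * a, l)" "(- 1, 0)" "(- 1, 0)"])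
         (use l in \<open>simp_all add: f 2 cross_def eval_nat_numeral algebra_simps\<close>)
  next
    case (3 a b)
    show ?thesis
      by (rule that[of "(l * a, l)" "(b, 1)" "(- 1, 0)"])
         (use l in \<open>simp_all add: f 3 cross_def eval_nat_numeral algebra_simps\<close>)
  next
    case (4 a b c)
    show ?thesis
      by (rule that[of "(l * a, l)" "(b, 1)" "(c, 1)"])
         (use l in \<open>simp_all add: f 4 cross_def eval_nat_numeral algebra_simps\<close>)
  qed
qed

text \<open>
  If the cubic vanished identically, then \<open>P = x L\<close> and \<open>Q = y L\<close> with a linear form \<open>L\<close>, and the zero of
  \<open>L\<close> would be a common zero of \<open>P\<close> and \<open>Q\<close>.
\<close>

lemma fixed_split_exists:
  assumes "is_lift \<phi> p q"
  obtains v1 v2 v3 where "fixed_split p q v1 v2 v3"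
proof -
  define f where "f = [:coeff p 0, coeff p 1 - coeff q 0, coeff p 2 - coeff q 1, - coeff q 2:]"
  have form: "fixed_form p q (x, y)
      = coeff f 3 * x^3 + coeff f 2 * x^2 * y + coeff f 1 * x * y^2 + coeff f 0 * y^3" for x y
    by (simp add: f_def fixed_form_def cross_def lift_map_def quad_form_def eval_nat_numeral
        algebra_simps)
  have "f \<noteq> 0"
  proof
    assume "f = 0"
    hence e: "coeff p 0 = 0" "coeff p 1 = coeff q 0" "coeff p 2 = coeff q 1" "coeff q 2 = 0"
      by (simp_all add: f_def)
    show False
    proof (cases "coeff q 0 = 0 \<and> coeff q 1 = 0")
      case True
      have "quad_form p 1 0 = 0" "quad_form q 1 0 = 0"
        using e True by (simp_all add: quad_form_def)
      from is_liftD(4)[OF assms this] show False by simp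
    next
      case False
      have "quad_form p (coeff q 0) (- coeff q 1) = 0" "quad_form q (coeff q 0) (- coeff q 1) = 0"
        unfolding quad_form_def e by (simp_all add: algebra_simps power2_eq_square)
      from is_liftD(4)[OF assms this] False show False by simp
    qed
  qed
  moreover have "degree f \<le> 3"
    by (simp add: f_def)
  ultimately obtain v1 v2 v3 where v: "v1 \<noteq> (0, 0)" "v2 \<noteq> (0, 0)" "v3 \<noteq> (0, 0)"
    "\<And>x y. coeff f 3 * x^3 + coeff f 2 * x^2 * y + coeff f 1 * x * y^2 + coeff f 0 * y^3
       = cross (x, y) v1 * cross (x, y) v2 * cross (x, y) v3"
    using cubic_form_splits by blast
  have "fixed_split p q v1 v2 v3"
    unfolding fixed_split_def using v(1-3) form v(4) by auto
  thus ?thesis by (rule that)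
qed

section \<open>Invariance under conjugation\<close>

definition lin_map :: "qbar \<Rightarrow> qbar \<Rightarrow> qbar \<Rightarrow> qbar \<Rightarrow> qbar \<times> qbar \<Rightarrow> qbar \<times> qbar" where
  "lin_map \<alpha> \<beta> \<gamma> \<delta> v = (\<alpha> * fst v + \<beta> * snd v, \<gamma> * fst v + \<delta> * snd v)"

text \<open>
  Together with the denominator below, the lift \<open>adj(A) \<circ> \<Phi> \<circ> A\<close> for the matrix
  \<open>A = (\<alpha>, \<beta>; \<gamma>, \<delta>)\<close>. The adjugate replaces the inverse so that no division is needed; this changes
  the lift by the factor \<open>det A\<close> only.
\<close>

definition conj_num :: "qbar poly \<Rightarrow> qbar poly \<Rightarrow> qbar \<Rightarrow> qbar \<Rightarrow> qbar \<Rightarrow> qbar \<Rightarrow> qbar poly" where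
  "conj_num p q \<alpha> \<beta> \<gamma> \<delta> =
     smult \<delta> (quad_subst p [:\<beta>, \<alpha>:] [:\<delta>, \<gamma>:]) - smult \<beta> (quad_subst q [:\<beta>, \<alpha>:] [:\<delta>, \<gamma>:])"

definition conj_den :: "qbar poly \<Rightarrow> qbar poly \<Rightarrow> qbar \<Rightarrow> qbar \<Rightarrow> qbar \<Rightarrow> qbar \<Rightarrow> qbar poly" where
  "conj_den p q \<alpha> \<beta> \<gamma> \<delta> =
     smult \<alpha> (quad_subst q [:\<beta>, \<alpha>:] [:\<delta>, \<gamma>:]) - smult \<gamma> (quad_subst p [:\<beta>, \<alpha>:] [:\<delta>, \<gamma>:])"

lemma quad_subst_linear:
  "quad_subst p [:\<beta>, \<alpha>:] [:\<delta>, \<gamma>:] =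
     [:coeff p 2 * \<beta>^2 + coeff p 1 * (\<beta> * \<delta>) + coeff p 0 * \<delta>^2,
       2 * coeff p 2 * (\<alpha> * \<beta>) + coeff p 1 * (\<alpha> * \<delta> + \<beta> * \<gamma>) + 2 * coeff p 0 * (\<gamma> * \<delta>),
       coeff p 2 * \<alpha>^2 + coeff p 1 * (\<alpha> * \<gamma>) + coeff p 0 * \<gamma>^2:]"
  by (simp add: quad_subst_def power2_eq_square algebra_simps)

lemma quad_form_subst:
  "quad_form (quad_subst p [:\<beta>, \<alpha>:] [:\<delta>, \<gamma>:]) x y = quad_form p (\<alpha> * x + \<beta> * y) (\<gamma> * x + \<delta> * y)"
  unfolding quad_subst_linear
  by (simp add: quad_form_def eval_nat_numeral algebra_simps)

lemma degree_conj:
  "degree (conj_num p q \<alpha> \<beta> \<gamma> \<delta>) \<le> 2" "degree (conj_den p q \<alpha> \<beta> \<gamma> \<delta>) \<le> 2"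
proof -
  have "degree (quad_subst r [:\<beta>, \<alpha>:] [:\<delta>, \<gamma>:]) \<le> 2" for r
    unfolding quad_subst_linear by (rule degree_quadratic_le)
  thus "degree (conj_num p q \<alpha> \<beta> \<gamma> \<delta>) \<le> 2" "degree (conj_den p q \<alpha> \<beta> \<gamma> \<delta>) \<le> 2"
    unfolding conj_num_def conj_den_def
    by (intro degree_diff_le order.trans[OF degree_smult_le]; simp)+
qed

lemma quad_form_diff_smult:
  "quad_form (smult a p - smult b q) x y = a * quad_form p x y - b * quad_form q x y"
  by (simp add: quad_form_def algebra_simps)

context
  fixes p q :: "qbar poly" and \<alpha> \<beta> \<gamma> \<delta> :: qbar
begin

private abbreviation (input) "p' \<equiv> conj_num p q \<alpha> \<beta> \<gamma> \<delta>"
private abbreviation (input) "q' \<equiv> conj_den p q \<alpha> \<beta> \<gamma> \<delta>"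
private abbreviation (input) "A \<equiv> lin_map \<alpha> \<beta> \<gamma> \<delta>"
private abbreviation (input) "adj \<equiv> lin_map \<delta> (- \<beta>) (- \<gamma>) \<alpha>"
private abbreviation (input) "d \<equiv> \<alpha> * \<delta> - \<beta> * \<gamma>"

lemma lift_map_conj: "lift_map p' q' v = adj (lift_map p q (A v))"
  by (simp add: lift_map_def lin_map_def conj_num_def conj_den_def quad_form_diff_smult
      quad_form_subst algebra_simps)

lemma adj_lin_map: "adj (A v) = (d * fst v, d * snd v)" "A (adj v) = (d * fst v, d * snd v)"
  by (simp_all add: lin_map_def algebra_simps)

lemma cross_adj: "cross (adj v) w = cross v (A w)" "cross (A v) w = cross v (adj w)"
  by (simp_all add: lin_map_def cross_def algebra_simps)

lemma lin_map_nonzero: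
  assumes "d \<noteq> 0" "v \<noteq> (0, 0)"
  shows "A v \<noteq> (0, 0)" "adj v \<noteq> (0, 0)"
proof -
  show "A v \<noteq> (0, 0)"
  proof
    assume "A v = (0, 0)"
    hence "adj (A v) = (0, 0)" by (simp add: lin_map_def)
    thus False using assms by (simp add: adj_lin_map(1) prod_eq_iff)
  qed
  show "adj v \<noteq> (0, 0)"
  proof
    assume "adj v = (0, 0)"
    hence "A (adj v) = (0, 0)" by (simp add: lin_map_def)
    thus False using assms by (simp add: adj_lin_map(2) prod_eq_iff)
  qed
qed

lemma fixed_form_conj: "fixed_form p' q' v = fixed_form p q (A v)"
  by (simp add: fixed_form_def lift_map_conj cross_adj)

lemma fixed_split_conj:
  assumes "d \<noteq> 0" "fixed_split p q v1 v2 v3"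
  shows "fixed_split p' q' (adj v1) (adj v2) (adj v3)"
proof -
  note s = fixed_splitD[OF assms(2)]
  have "fixed_form p' q' v = cross v (adj v1) * cross v (adj v2) * cross v (adj v3)" for v
    unfolding fixed_form_conj s(4) cross_adj ..
  thus ?thesis
    unfolding fixed_split_def using lin_map_nonzero(2)[OF assms(1)] s(1-3) by blast
qed

lemma coeff_conj:
  "coeff p' 0 = \<delta> * (coeff p 2 * \<beta>^2 + coeff p 1 * (\<beta> * \<delta>) + coeff p 0 * \<delta>^2)
     - \<beta> * (coeff q 2 * \<beta>^2 + coeff q 1 * (\<beta> * \<delta>) + coeff q 0 * \<delta>^2)"
  "coeff p' 1 = \<delta> * (2 * coeff p 2 * (\<alpha> * \<beta>) + coeff p 1 * (\<alpha> * \<delta> + \<beta> * \<gamma>) + 2 * coeff p 0 * (\<gamma> * \<delta>))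
     - \<beta> * (2 * coeff q 2 * (\<alpha> * \<beta>) + coeff q 1 * (\<alpha> * \<delta> + \<beta> * \<gamma>) + 2 * coeff q 0 * (\<gamma> * \<delta>))"
  "coeff p' 2 = \<delta> * (coeff p 2 * \<alpha>^2 + coeff p 1 * (\<alpha> * \<gamma>) + coeff p 0 * \<gamma>^2)
     - \<beta> * (coeff q 2 * \<alpha>^2 + coeff q 1 * (\<alpha> * \<gamma>) + coeff q 0 * \<gamma>^2)"
  "coeff q' 0 = \<alpha> * (coeff q 2 * \<beta>^2 + coeff q 1 * (\<beta> * \<delta>) + coeff q 0 * \<delta>^2)
     - \<gamma> * (coeff p 2 * \<beta>^2 + coeff p 1 * (\<beta> * \<delta>) + coeff p 0 * \<delta>^2)"
  "coeff q' 1 = \<alpha> * (2 * coeff q 2 * (\<alpha> * \<beta>) + coeff q 1 * (\<alpha> * \<delta> + \<beta> * \<gamma>) + 2 * coeff q 0 * (\<gamma> * \<delta>))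
     - \<gamma> * (2 * coeff p 2 * (\<alpha> * \<beta>) + coeff p 1 * (\<alpha> * \<delta> + \<beta> * \<gamma>) + 2 * coeff p 0 * (\<gamma> * \<delta>))"
  "coeff q' 2 = \<alpha> * (coeff q 2 * \<alpha>^2 + coeff q 1 * (\<alpha> * \<gamma>) + coeff q 0 * \<gamma>^2)
     - \<gamma> * (coeff p 2 * \<alpha>^2 + coeff p 1 * (\<alpha> * \<gamma>) + coeff p 0 * \<gamma>^2)"
  by (simp_all add: conj_num_def conj_den_def quad_subst_linear eval_nat_numeral)

lemma jacobian_trace_conj: "jacobian_trace p' q' v = d * jacobian_trace p q (A v)"
  unfolding jacobian_trace_def coeff_conj
  by (simp add: lin_map_def algebra_simps power2_eq_square)

lemma wronskian_conj: "wronskian p' q' v = d^2 * wronskian p q (A v)"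
  unfolding wronskian_def coeff_conj
  by (simp add: lin_map_def algebra_simps power2_eq_square)

text \<open>
  Trace and eigenvalue of the conjugated lift at \<open>adj(A) v\<close> are those of the original one at \<open>v\<close>, both
  multiplied by \<open>(det A)\<^sup>2\<close>.
\<close>

lemma lift_multiplier_conj:
  assumes "is_lift \<phi> p q" "d \<noteq> 0" "v \<noteq> (0, 0)" "fixed_form p q v = 0"
  shows "lift_multiplier p' q' (adj v) = lift_multiplier p q v"
proof -
  define l where "l = eigenvalue p q v"
  have l: "lift_map p q v = (l * fst v, l * snd v)" "l \<noteq> 0"
    using eigenvalue[OF assms(1,3,4)] by (simp_all add: l_def)
  have "lift_map p' q' (adj v) = adj (lift_map p q (d * fst v, d * snd v))"
    by (simp add: lift_map_conj adj_lin_map)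
  also have "\<dots> = (d^2 * l * fst (adj v), d^2 * l * snd (adj v))"
    unfolding lift_map_scale by (simp add: l) (simp add: lin_map_def algebra_simps)
  finally have "lift_multiplier p' q' (adj v) = jacobian_trace p' q' (adj v) / (d^2 * l) - 2"
    using lin_map_nonzero(2)[OF assms(2,3)] by (rule lift_multiplier_eq)
  moreover have "jacobian_trace p' q' (adj v) = d^2 * jacobian_trace p q v"
    unfolding jacobian_trace_conj adj_lin_map
    by (simp add: jacobian_trace_def algebra_simps power2_eq_square)
  moreover have "lift_multiplier p q v = jacobian_trace p q v / l - 2"
    using l assms(3) by (intro lift_multiplier_eq) auto
  ultimately show ?thesis using assms(2) by simp
qed

lemma mult_sigma_conj:
  assumes "is_lift \<phi> p q" "is_lift \<psi> p' q'" "d \<noteq> 0"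
  shows "mult_sigma 1 \<psi> = mult_sigma 1 \<phi>" "mult_sigma 2 \<psi> = mult_sigma 2 \<phi>"
proof -
  obtain v1 v2 v3 where s: "fixed_split p q v1 v2 v3"
    using fixed_split_exists[OF assms(1)] .
  note sD = fixed_splitD[OF s]
  note s' = fixed_split_conj[OF assms(3) s]
  have "fixed_form p q v1 = 0" "fixed_form p q v2 = 0" "fixed_form p q v3 = 0"
    by (simp_all add: sD(4)) (simp_all add: cross_def)
  note m = lift_multiplier_conj[OF assms(1,3) sD(1) this(1)]
    lift_multiplier_conj[OF assms(1,3) sD(2) this(2)]
    lift_multiplier_conj[OF assms(1,3) sD(3) this(3)]
  show "mult_sigma 1 \<psi> = mult_sigma 1 \<phi>"
    unfolding mult_sigma_split(1)[OF assms(1) s] mult_sigma_split(1)[OF assms(2) s'] m ..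
  show "mult_sigma 2 \<psi> = mult_sigma 2 \<phi>"
    unfolding mult_sigma_split(2)[OF assms(1) s] mult_sigma_split(2)[OF assms(2) s'] m ..
qed

lemma is_lift_conj:
  assumes "is_lift \<phi> p q" "d \<noteq> 0"
  shows "is_lift (to_fract p' / to_fract q') p' q'"
proof -
  have "x = 0 \<and> y = 0" if "quad_form p' x y = 0" "quad_form q' x y = 0" for x y
  proof (rule ccontr)
    assume "\<not> (x = 0 \<and> y = 0)"
    hence "(x, y) \<noteq> (0, 0)" by simp
    hence "lift_map p' q' (x, y) \<noteq> (0, 0)"
      unfolding lift_map_conj using assms lift_map_nonzero lin_map_nonzero by blast
    thus False using that by (simp add: lift_map_def)
  qed
  thus ?thesis unfolding is_lift_def using degree_conj by blast
qed

text \<open>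
  The orbits of \<open>\<psi>\<close> are mapped to those of \<open>\<phi>\<close> by \<open>A\<close>, because \<open>A (adj(A) u) = (det A) u\<close>.
\<close>

lemma rf_eval_conj:
  assumes "is_lift \<phi> p q" "is_lift \<psi> p' q'" "d \<noteq> 0" "v \<noteq> (0, 0)"
  shows "\<exists>z. z \<noteq> (0, 0) \<and> (rf_eval \<phi> ^^ k) (proj_point (A v)) = proj_point (A z)
           \<and> (rf_eval \<psi> ^^ k) (proj_point v) = proj_point z"
proof (induction k)
  case 0
  show ?case by (rule exI[of _ v]) (use assms(4) in simp)
next
  case (Suc k)
  then obtain z where z: "z \<noteq> (0, 0)" "(rf_eval \<phi> ^^ k) (proj_point (A v)) = proj_point (A z)"
    "(rf_eval \<psi> ^^ k) (proj_point v) = proj_point z" by blast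
  have "(rf_eval \<phi> ^^ Suc k) (proj_point (A v)) = proj_point (lift_map p q (A z))"
    by (simp add: z(2) rf_eval_lift[OF assms(1) lin_map_nonzero(1)[OF assms(3) z(1)]])
  also have "\<dots> = proj_point (A (lift_map p' q' z))"
    unfolding lift_map_conj adj_lin_map using assms(3) by (simp add: proj_point_scale)
  finally have "(rf_eval \<phi> ^^ Suc k) (proj_point (A v)) = proj_point (A (lift_map p' q' z))" .
  moreover have "(rf_eval \<psi> ^^ Suc k) (proj_point v) = proj_point (lift_map p' q' z)"
    by (simp add: z(3) rf_eval_lift[OF assms(2) z(1)])
  ultimately show ?case
    using lift_map_nonzero[OF assms(2) z(1)] by blast
qed

lemma exact_period_conj:
  assumes "is_lift \<phi> p q" "is_lift \<psi> p' q'" "d \<noteq> 0" "v \<noteq> (0, 0)"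
  shows "exact_period \<psi> (proj_point v) n \<longleftrightarrow> exact_period \<phi> (proj_point (A v)) n"
proof -
  have "(rf_eval \<psi> ^^ k) (proj_point v) = proj_point v \<longleftrightarrow>
      (rf_eval \<phi> ^^ k) (proj_point (A v)) = proj_point (A v)" for k
  proof -
    obtain z where z: "z \<noteq> (0, 0)" "(rf_eval \<phi> ^^ k) (proj_point (A v)) = proj_point (A z)"
      "(rf_eval \<psi> ^^ k) (proj_point v) = proj_point z"
      using rf_eval_conj[OF assms] by blast
    have "cross (A z) (A v) = d * cross z v"
      by (simp add: lin_map_def cross_def algebra_simps)
    thus ?thesis
      unfolding z(2,3) proj_point_eq_iff[OF z(1) assms(4)]
        proj_point_eq_iff[OF lin_map_nonzero(1)[OF assms(3) z(1)] lin_map_nonzero(1)[OF assms(3,4)]]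
      using assms(3) by simp
  qed
  thus ?thesis unfolding exact_period_def by blast
qed

end

text \<open>
  From \<open>\<tau> \<circ> \<sigma> = x\<close> it follows that the matrix \<open>N\<close> of \<open>\<tau>\<close> satisfies \<open>N A = e I\<close>, hence
  \<open>det(A) N = e adj(A)\<close>; so \<open>\<tau>\<close> is given by the adjugate of the matrix of \<open>\<sigma>\<close>.
\<close>

lemma conj_rel_lift:
  assumes "(\<phi>, \<psi>) \<in> conj_rel" "is_lift \<phi> p q"
  obtains \<alpha> \<beta> \<gamma> \<delta> where "\<alpha> * \<delta> - \<beta> * \<gamma> \<noteq> 0"
    "is_lift \<psi> (conj_num p q \<alpha> \<beta> \<gamma> \<delta>) (conj_den p q \<alpha> \<beta> \<gamma> \<delta>)"
proof -
  obtain \<sigma> \<tau> where st: "rf_degree \<psi> = 2" "rf_degree \<sigma> = 1" "rf_degree \<tau> = 1"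
    "rf_comp \<tau> \<sigma> = rf_X" "\<psi> = rf_comp \<tau> (rf_comp \<phi> \<sigma>)"
    using assms(1) unfolding conj_rel_def by blast
  have deg_1: "r = [:coeff r 0, coeff r 1:]" if "degree r \<le> 1" for r :: "qbar poly"
  proof -
    have "coeff r 2 = 0" using that by (intro coeff_eq_0) simp
    thus ?thesis using degree_le_2_eq[of r] that by simp
  qed
  have deg: "degree (rf_num \<sigma>) \<le> 1" "degree (rf_den \<sigma>) \<le> 1" "degree (rf_num \<tau>) \<le> 1"
    "degree (rf_den \<tau>) \<le> 1"
    using st(2,3) by (simp_all add: rf_degree_def)
  define \<alpha> \<beta> \<gamma> \<delta> where "\<alpha> = coeff (rf_num \<sigma>) 1" and "\<beta> = coeff (rf_num \<sigma>) 0"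
    and "\<gamma> = coeff (rf_den \<sigma>) 1" and "\<delta> = coeff (rf_den \<sigma>) 0"
  (* The matrix of sigma is (alpha, beta; gamma, delta), that of tau is (n1, n0; d1, d0). *)
  define n1 n0 d1 d0 where "n1 = coeff (rf_num \<tau>) 1" and "n0 = coeff (rf_num \<tau>) 0"
    and "d1 = coeff (rf_den \<tau>) 1" and "d0 = coeff (rf_den \<tau>) 0"
  define u w where "u = [:\<beta>, \<alpha>:]" and "w = [:\<delta>, \<gamma>:]"
  have uw: "rf_num \<sigma> = u" "rf_den \<sigma> = w"
    unfolding u_def w_def \<alpha>_def \<beta>_def \<gamma>_def \<delta>_def by (rule deg_1[OF deg(1)], rule deg_1[OF deg(2)])
  have w0: "w \<noteq> 0" using rf_num_den(1)[of \<sigma>] by (simp add: uw)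
  have \<sigma>: "\<sigma> = to_fract u / to_fract w"
    using rf_num_den(3)[of \<sigma>] by (simp only: uw)
  have \<tau>: "rf_comp \<tau> (to_fract u / to_fract w)
      = to_fract (smult n1 u + smult n0 w) / to_fract (smult d1 u + smult d0 w)"
    if "w \<noteq> 0" for u w
    unfolding n0_def n1_def d0_def d1_def by (rule rf_comp_linear[OF deg(3,4) that])
  have X: "to_fract (smult n1 u + smult n0 w) / to_fract (smult d1 u + smult d0 w)
      = to_fract [:0, 1:]"
    using st(4) unfolding \<sigma> \<tau>[OF w0] rf_X_def .
  have den0: "smult d1 u + smult d0 w \<noteq> 0"
  proof
    assume "smult d1 u + smult d0 w = 0"
    with X have "to_fract [:0, 1 :: qbar:] = 0" by simp
    thus False by (simp del: to_fract_0 add: to_fract_eq_0_iff)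
  qed
  hence nz: "to_fract (smult d1 u + smult d0 w) \<noteq> 0"
    by (simp only: to_fract_eq_0_iff not_False_eq_True)
  have "to_fract (smult n1 u + smult n0 w)
      = to_fract ([:0, 1:] * (smult d1 u + smult d0 w))"
    unfolding to_fract_mult by (rule iffD1[OF nonzero_divide_eq_eq[OF nz] X])
  hence "smult n1 u + smult n0 w = [:0, 1:] * (smult d1 u + smult d0 w)"
    by (simp only: to_fract_eq_iff)
  hence e: "n1 * \<beta> + n0 * \<delta> = 0" "n1 * \<alpha> + n0 * \<gamma> = d1 * \<beta> + d0 * \<delta>" "d1 * \<alpha> + d0 * \<gamma> = 0"
    by (simp_all add: u_def w_def)
  define e where "e = d1 * \<beta> + d0 * \<delta>"
  define d where "d = \<alpha> * \<delta> - \<beta> * \<gamma>"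
  have e0: "e \<noteq> 0"
    using den0 e(3) by (simp add: u_def w_def e_def)
  have N: "n1 * d = e * \<delta>" "n0 * d = - (e * \<beta>)" "d1 * d = - (e * \<gamma>)" "d0 * d = e * \<alpha>"
  proof -
    have "n1 * d = (n1 * \<alpha> + n0 * \<gamma>) * \<delta> - (n1 * \<beta> + n0 * \<delta>) * \<gamma>"
      "n0 * d = (n1 * \<beta> + n0 * \<delta>) * \<alpha> - (n1 * \<alpha> + n0 * \<gamma>) * \<beta>"
      "d1 * d = (d1 * \<alpha> + d0 * \<gamma>) * \<delta> - (d1 * \<beta> + d0 * \<delta>) * \<gamma>"
      "d0 * d = (d1 * \<beta> + d0 * \<delta>) * \<alpha> - (d1 * \<alpha> + d0 * \<gamma>) * \<beta>"
      by (simp_all add: d_def algebra_simps)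
    thus "n1 * d = e * \<delta>" "n0 * d = - (e * \<beta>)" "d1 * d = - (e * \<gamma>)" "d0 * d = e * \<alpha>"
      unfolding e by (simp_all add: e_def)
  qed
  have d0: "d \<noteq> 0"
  proof
    assume "d = 0"
    hence "\<alpha> = 0" "\<beta> = 0" "\<gamma> = 0" "\<delta> = 0"
      using N e0 by simp_all
    thus False using w0 by (simp add: w_def)
  qed
  define U W where "U = quad_subst p u w" and "W = quad_subst q u w"
  have W0: "W \<noteq> 0"
  proof
    assume "W = 0"
    have "degree p \<le> 2" by (rule is_liftD(1)[OF assms(2)])
    then obtain x y where xy: "quad_form p x y = 0" "\<not> (x = 0 \<and> y = 0)"
      using quad_form_has_zero by blast
    define x' y' where "x' = (\<delta> * x - \<beta> * y) / d" and "y' = (\<alpha> * y - \<gamma> * x) / d"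
    have "\<alpha> * x' + \<beta> * y' = x * d / d" "\<gamma> * x' + \<delta> * y' = y * d / d"
      unfolding x'_def y'_def times_divide_eq_right add_divide_distrib[symmetric]
      by (simp_all add: d_def algebra_simps)
    hence "\<alpha> * x' + \<beta> * y' = x" "\<gamma> * x' + \<delta> * y' = y"
      using d0 by simp_all
    hence "quad_form q x y = quad_form W x' y'"
      unfolding W_def u_def w_def quad_form_subst by simp
    also have "\<dots> = 0" by (simp add: \<open>W = 0\<close> quad_form_def)
    finally have "quad_form q x y = 0" .
    with xy is_liftD(4)[OF assms(2)] show False by blast
  qed
  have "\<psi> = to_fract (smult n1 U + smult n0 W) / to_fract (smult d1 U + smult d0 W)"
    unfolding st(5) unfolding \<sigma> rf_comp_lift[OF assms(2) w0] U_def[symmetric] W_def[symmetric]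
    by (rule \<tau>[OF W0])
  also have "\<dots> = to_fract (smult (d / e) (smult n1 U + smult n0 W))
      / to_fract (smult (d / e) (smult d1 U + smult d0 W))"
  proof -
    have "rf_const (d / e) \<noteq> 0" using d0 e0 by (simp add: rf_const_def)
    thus ?thesis by (simp add: to_fract_smult del: smult_add_right)
  qed
  also have "smult (d / e) (smult n1 U + smult n0 W) = conj_num p q \<alpha> \<beta> \<gamma> \<delta>"
  proof -
    have "d / e * n1 = \<delta>" "d / e * n0 = - \<beta>" using N e0 by (simp_all add: field_simps)
    thus ?thesis
      unfolding conj_num_def U_def[unfolded u_def w_def, symmetric] W_def[unfolded u_def w_def, symmetric]
      by (simp add: smult_add_right)
  qed
  also have "smult (d / e) (smult d1 U + smult d0 W) = conj_den p q \<alpha> \<beta> \<gamma> \<delta>"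
  proof -
    have "d / e * d1 = - \<gamma>" "d / e * d0 = \<alpha>" using N e0 by (simp_all add: field_simps)
    thus ?thesis
      unfolding conj_den_def U_def[unfolded u_def w_def, symmetric] W_def[unfolded u_def w_def, symmetric]
      by (simp add: smult_add_right)
  qed
  finally have "is_lift \<psi> (conj_num p q \<alpha> \<beta> \<gamma> \<delta>) (conj_den p q \<alpha> \<beta> \<gamma> \<delta>)"
    using degree_conj by (rule is_lift_if_degree_2[OF st(1)])
  thus ?thesis using that d0 unfolding d_def by blast
qed

lemma conj_rel_refl:
  assumes "rf_degree \<phi> = 2"
  shows "(\<phi>, \<phi>) \<in> conj_rel"
proof -
  have nd: "rf_num rf_X = [:0, 1:]" "rf_den rf_X = 1"
    by (simp_all add: rf_num_def rf_den_def rf_X_def)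
  have m: "map_poly rf_const [:0, 1:] = [:0, 1:]" "map_poly rf_const 1 = 1"
    by (simp_all add: map_poly_pCons one_pCons)
  have X: "rf_comp rf_X \<chi> = \<chi>" for \<chi>
    by (simp add: rf_comp_def nd m)
  obtain p q where l: "is_lift \<phi> p q" using is_lift_exists[OF assms] .
  have s: "quad_subst r [:0, 1:] 1 = r" if "degree r \<le> 2" for r
  proof -
    have "quad_subst r [:0, 1:] 1 = [:coeff r 0, coeff r 1, coeff r 2:]"
      by (simp add: quad_subst_def power2_eq_square one_pCons)
    thus ?thesis using degree_le_2_eq[OF that] by simp
  qed
  have "rf_comp \<phi> rf_X = \<phi>"
    using rf_comp_lift[OF l, of 1 "[:0, 1:]"] is_liftD(1-3)[OF l] by (simp add: s rf_X_def)
  moreover have "rf_degree rf_X = 1" by (simp add: rf_degree_def nd)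
  ultimately show ?thesis
    unfolding conj_rel_def using assms X by auto
qed

text \<open>
  This makes \<open>the_elem\<close> meaningful: the symmetric functions are constant on the class, and the class is
  not empty.
\<close>

lemma moduli_coords_conj_class:
  assumes "rf_degree \<phi> = 2"
  shows "moduli_coords (conj_class \<phi>) = (mult_sigma 1 \<phi>, mult_sigma 2 \<phi>)"
proof -
  obtain p q where l: "is_lift \<phi> p q" using is_lift_exists[OF assms] .
  define f where "f \<psi> = (mult_sigma 1 \<psi>, mult_sigma 2 \<psi>)" for \<psi>
  have const: "f \<psi> = f \<phi>" if "\<psi> \<in> conj_class \<phi>" for \<psi>
  proof -
    have rel: "(\<phi>, \<psi>) \<in> conj_rel" using that by (simp add: conj_class_def)
    obtain \<alpha> \<beta> \<gamma> \<delta> where d: "\<alpha> * \<delta> - \<beta> * \<gamma> \<noteq> 0"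
      and l': "is_lift \<psi> (conj_num p q \<alpha> \<beta> \<gamma> \<delta>) (conj_den p q \<alpha> \<beta> \<gamma> \<delta>)"
      using conj_rel_lift[OF rel l] .
    show ?thesis
      unfolding f_def by (simp only: mult_sigma_conj[OF l l' d])
  qed
  have "\<phi> \<in> conj_class \<phi>"
    using conj_rel_refl[OF assms] by (simp add: conj_class_def)
  hence "f ` conj_class \<phi> = {f \<phi>}"
    using const by blast
  thus ?thesis
    unfolding moduli_coords_def f_def by simp
qed

section \<open>Normal form for a critical point that is not fixed\<close>

definition critical_family :: "qbar \<Rightarrow> qbar \<Rightarrow> qbar \<Rightarrow> qbar \<Rightarrow> ratfun" where
  "critical_family a0 b0 b1 b2 = to_fract [:a0:] / to_fract [:b0, b1, b2:]"

lemma lift_map_critical_family: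
  "lift_map [:a0:] [:b0, b1, b2:] (x, y) = (a0 * y^2, b2 * x^2 + b1 * (x * y) + b0 * y^2)"
  by (simp add: lift_map_def quad_form_def eval_nat_numeral)

lemma is_lift_critical_family:
  assumes "a0 \<noteq> 0" "b2 \<noteq> 0"
  shows "is_lift (critical_family a0 b0 b1 b2) [:a0:] [:b0, b1, b2:]"
proof -
  have "x = 0 \<and> y = 0" if "quad_form [:a0:] x y = 0" "quad_form [:b0, b1, b2:] x y = 0" for x y
  proof -
    have "lift_map [:a0:] [:b0, b1, b2:] (x, y) = (0, 0)"
      using that by (simp add: lift_map_def)
    thus ?thesis using assms by (auto simp: lift_map_critical_family)
  qed
  moreover have "degree [:a0:] \<le> 2" by simp
  ultimately show ?thesis
    unfolding is_lift_def critical_family_def using degree_quadratic_le[of b0 b1 b2] by blast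
qed

text \<open>
  The coordinates have \<open>P\<close> at \<open>\<infinity>\<close> and \<open>\<phi>(P)\<close> at \<open>0\<close>: the columns of the matrix are a vector \<open>v\<close> over
  \<open>P\<close> and \<open>\<Phi>(v)\<close>, which are independent because \<open>P\<close> is not fixed. Then \<open>\<infinity>\<close> is mapped to \<open>0\<close>, which
  removes \<open>x\<^sup>2\<close> from the numerator, and criticality removes \<open>x\<close>.
\<close>

lemma critical_normal_form:
  assumes "rf_degree \<phi> = 2" "critical_point \<phi> P" "rf_eval \<phi> P \<noteq> P"
  obtains a0 b0 b1 b2 where "a0 \<noteq> 0" "b2 \<noteq> 0"
    "mult_sigma 1 (critical_family a0 b0 b1 b2) = mult_sigma 1 \<phi>"
    "mult_sigma 2 (critical_family a0 b0 b1 b2) = mult_sigma 2 \<phi>"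
    "\<And>n. exact_period (critical_family a0 b0 b1 b2) Infty n \<longleftrightarrow> exact_period \<phi> P n"
proof -
  obtain p q where l: "is_lift \<phi> p q" using is_lift_exists[OF assms(1)] .
  obtain v where v: "v \<noteq> (0, 0)" "P = proj_point v" by (rule proj_point_surj)
  define w where "w = lift_map p q v"
  have w0: "w \<noteq> (0, 0)" unfolding w_def by (rule lift_map_nonzero[OF l v(1)])
  obtain \<alpha> \<gamma> where \<alpha>\<gamma>: "v = (\<alpha>, \<gamma>)" by (cases v)
  obtain \<beta> \<delta> where \<beta>\<delta>: "w = (\<beta>, \<delta>)" by (cases w)
  define d where "d = \<alpha> * \<delta> - \<beta> * \<gamma>"
  have "proj_point w \<noteq> proj_point v"
    using assms(3) unfolding v(2) rf_eval_lift[OF l v(1)] w_def .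
  hence "cross w v \<noteq> 0"
    unfolding proj_point_eq_iff[OF w0 v(1)] .
  hence d0: "\<alpha> * \<delta> - \<beta> * \<gamma> \<noteq> 0"
    by (auto simp: cross_def \<alpha>\<gamma> \<beta>\<delta> mult.commute)
  define p' q' where "p' = conj_num p q \<alpha> \<beta> \<gamma> \<delta>" and "q' = conj_den p q \<alpha> \<beta> \<gamma> \<delta>"
  have e1: "lin_map \<alpha> \<beta> \<gamma> \<delta> (1, 0) = v" by (simp add: lin_map_def \<alpha>\<gamma>)
  have "lift_map p' q' (1, 0) = lin_map \<delta> (- \<beta>) (- \<gamma>) \<alpha> w"
    unfolding p'_def q'_def lift_map_conj e1 w_def ..
  hence c2: "coeff p' 2 = 0" "coeff q' 2 = d"
    by (simp_all add: lift_map_def quad_form_def lin_map_def \<beta>\<delta> d_def mult.commute)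
  have "wronskian p q v = 0"
    using assms(2) unfolding v(2) critical_point_lift[OF l v(1)] .
  hence "wronskian p' q' (1, 0) = 0"
    unfolding p'_def q'_def wronskian_conj e1 by simp
  hence c1: "coeff p' 1 = 0"
    using d0 by (simp add: wronskian_def c2) (simp add: d_def)
  have deg: "degree p' \<le> 2" "degree q' \<le> 2"
    unfolding p'_def q'_def by (rule degree_conj)+
  define a0 b0 b1 where "a0 = coeff p' 0" and "b0 = coeff q' 0" and "b1 = coeff q' 1"
  have p': "p' = [:a0:]"
    by (rule trans[OF degree_le_2_eq[OF deg(1)]]) (simp only: c1 c2 a0_def pCons_0_0)
  have q': "q' = [:b0, b1, d:]"
    by (rule trans[OF degree_le_2_eq[OF deg(2)]]) (simp only: c2 b0_def b1_def)
  have l': "is_lift (critical_family a0 b0 b1 d) p' q'"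
    using is_lift_conj[OF l d0]
    unfolding critical_family_def p'[symmetric] q'[symmetric] unfolding p'_def q'_def .
  have "a0 \<noteq> 0" using is_lift_nonzero(1)[OF l'] by (simp add: p')
  moreover have "d \<noteq> 0" using d0 by (simp add: d_def)
  moreover note mult_sigma_conj[OF l l'[unfolded p'_def q'_def] d0]
  moreover have "exact_period (critical_family a0 b0 b1 d) Infty n \<longleftrightarrow> exact_period \<phi> P n" for n
  proof -
    have "proj_point (1, 0) = Infty" by (simp add: proj_point_def)
    thus ?thesis
      using exact_period_conj[OF l l'[unfolded p'_def q'_def] d0, of "(1, 0)" n]
      by (simp add: e1 v(2))
  qed
  ultimately show ?thesis by (rule that)
qed

text \<open>
  The fixed points \<open>x\<^sub>i\<close> are the roots of \<open>b\<^sub>2 x\<^sup>3 + b\<^sub>1 x\<^sup>2 + b\<^sub>0 x - a\<^sub>0\<close>, and their multipliers are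
  \<open>(b\<^sub>1 x\<^sub>i\<^sup>2 + 2 b\<^sub>0 x\<^sub>i) / a\<^sub>0 - 2\<close>. The combinations \<open>\<sigma>\<^sub>1 + 6\<close> and \<open>\<sigma>\<^sub>2 + 2\<sigma>\<^sub>1\<close> are chosen because they have
  short expressions in the elementary symmetric functions of the \<open>x\<^sub>i\<close>.
\<close>

lemma mult_sigma_critical_family:
  fixes a0 b0 b1 b2 :: qbar
  assumes "a0 \<noteq> 0" "b2 \<noteq> 0"
  defines "w \<equiv> b1 * b0 / (b2 * a0)" and "c \<equiv> b0^3 / (b2 * a0^2)"
  defines "\<psi> \<equiv> critical_family a0 b0 b1 b2"
  shows "mult_sigma 1 \<psi> + 6 = b1^3 / (a0 * b2^2) - 4 * w"
    and "mult_sigma 2 \<psi> + 2 * mult_sigma 1 \<psi> = 2 * w - w^2 + 4 * c"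
proof -
  define p q where "p = [:a0:]" and "q = [:b0, b1, b2:]"
  have l: "is_lift \<psi> p q"
    unfolding \<psi>_def p_def q_def by (rule is_lift_critical_family[OF assms(1,2)])
  obtain v1 v2 v3 where s: "fixed_split p q v1 v2 v3"
    using fixed_split_exists[OF l] .
  note sD = fixed_splitD[OF s]
  have F: "fixed_form p q (x, y) = a0 * y^3 - b2 * x^3 - b1 * x^2 * y - b0 * x * y^2" for x y
    unfolding p_def q_def
    by (simp add: fixed_form_def cross_def lift_map_critical_family algebra_simps
        power2_eq_square power3_eq_cube)
  have lead: "- b2 = snd v1 * snd v2 * snd v3"
    using sD(4)[of "(1, 0)"] by (simp add: F cross_def)
  hence y: "snd v1 \<noteq> 0" "snd v2 \<noteq> 0" "snd v3 \<noteq> 0"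
    using assms(2) by auto
  have b2: "b2 = - (snd v1 * snd v2 * snd v3)"
    by (simp only: lead[symmetric] minus_minus)
  define x1 x2 x3 where "x1 = fst v1 / snd v1" and "x2 = fst v2 / snd v2" and "x3 = fst v3 / snd v3"
  have root: "a0 - b2 * x^3 - b1 * x^2 - b0 * x = - b2 * ((x - x1) * (x - x2) * (x - x3))" for x
  proof -
    have lin: "cross (x, 1) u = snd u * (x - fst u / snd u)" if "snd u \<noteq> 0" for u
      using that by (simp add: cross_def field_simps)
    have "a0 - b2 * x^3 - b1 * x^2 - b0 * x = cross (x, 1) v1 * cross (x, 1) v2 * cross (x, 1) v3"
      using sD(4)[of "(x, 1)"] by (simp add: F)
    thus ?thesis
      unfolding lin[OF y(1)] lin[OF y(2)] lin[OF y(3)] b2 x1_def x2_def x3_def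
      by (simp add: mult_ac)
  qed
  define e1 e2 e3 where "e1 = x1 + x2 + x3" and "e2 = x1 * x2 + x1 * x3 + x2 * x3"
    and "e3 = x1 * x2 * x3"
  (* Vieta's formulas, read off from the values of the cubic at 0, 1 and -1. *)
  have a0: "a0 = b2 * e3" using root[of 0] by (simp add: e3_def)
  have r1: "a0 - b2 - b1 - b0 = - b2 * (1 - e1 + e2 - e3)"
    using root[of 1] by (simp add: e1_def e2_def e3_def algebra_simps)
  have r2: "a0 + b2 - b1 + b0 = - b2 * (- 1 - e1 - e2 - e3)"
    using root[of "- 1"] by (simp add: e1_def e2_def e3_def algebra_simps)
  have "2 * b1 = 2 * (- b2 * e1)"
  proof -
    have "2 * b1 = 2 * a0 - ((a0 - b2 - b1 - b0) + (a0 + b2 - b1 + b0))" by simp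
    also have "\<dots> = 2 * (- b2 * e1)" unfolding r1 r2 by (simp add: a0 algebra_simps)
    finally show ?thesis .
  qed
  hence b1: "b1 = - b2 * e1" by (simp only: mult_left_cancel[OF zero_neq_numeral[symmetric]])
  have "2 * b0 = 2 * (b2 * e2)"
  proof -
    have "2 * b0 = (a0 + b2 - b1 + b0) - (a0 - b2 - b1 - b0) - 2 * b2" by simp
    also have "\<dots> = 2 * (b2 * e2)" unfolding r1 r2 by (simp add: algebra_simps)
    finally show ?thesis .
  qed
  hence b0: "b0 = b2 * e2" by (simp only: mult_left_cancel[OF zero_neq_numeral[symmetric]])
  have e3: "e3 \<noteq> 0" using a0 assms(1) by auto
  have m: "lift_multiplier p q u = (2 * e2 * x - e1 * x^2) / e3 - 2"
    if u: "snd u \<noteq> 0" "fixed_form p q u = 0" "x = fst u / snd u" for u x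
  proof -
    have uu: "u = (snd u * x, snd u * 1)" using u(1,3) by (simp add: prod_eq_iff)
    have f: "fixed_form p q (x, 1) = 0"
      using u(1,2) by (subst (asm) uu, subst (asm) fixed_form_scale) simp
    hence f': "a0 = (b2 * x^2 + b1 * x + b0) * x"
      by (simp add: F algebra_simps power2_eq_square power3_eq_cube)
    have x0: "x \<noteq> 0" using f' assms(1) by auto
    have "lift_multiplier p q u = lift_multiplier p q (x, 1)"
      by (subst uu) (rule lift_multiplier_scale[OF u(1)])
    also have "\<dots> = jacobian_trace p q (x, 1) / (a0 / x) - 2"
    proof (rule lift_multiplier_eq)
      show "lift_map p q (x, 1) = (a0 / x * fst (x, 1), a0 / x * snd (x, 1))"
        unfolding p_def q_def lift_map_critical_family using x0 by (simp add: f')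
    qed simp
    also have "jacobian_trace p q (x, 1) = b1 * x + 2 * b0"
      by (simp add: jacobian_trace_def p_def q_def eval_nat_numeral)
    also have "(b1 * x + 2 * b0) / (a0 / x) = (2 * e2 * x - e1 * x^2) / e3"
      unfolding b1 b0 a0 using assms(2) e3 x0
      by (simp add: field_simps power2_eq_square)
    finally show ?thesis .
  qed
  have z: "fixed_form p q v1 = 0" "fixed_form p q v2 = 0" "fixed_form p q v3 = 0"
    by (simp_all add: sD(4)) (simp_all add: cross_def)
  define g where "g x = 2 * e2 * x - e1 * x^2" for x
  note ms = m[OF y(1) z(1) x1_def, folded g_def] m[OF y(2) z(2) x2_def, folded g_def]
    m[OF y(3) z(3) x3_def, folded g_def]
  have w: "w = - e1 * e2 / e3"
    unfolding w_def a0 b0 b1 using assms(2) e3 by (simp add: field_simps)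
  have c: "c = e2^3 / e3^2"
    unfolding c_def a0 b0 using assms(2) e3 by (simp add: field_simps eval_nat_numeral)
  have X: "b1^3 / (a0 * b2^2) = - (e1^3) / e3"
    unfolding a0 b1 using assms(2) e3 by (simp add: field_simps eval_nat_numeral)
  have "mult_sigma 1 \<psi> + 6 = (g x1 + g x2 + g x3) / e3"
    unfolding mult_sigma_split(1)[OF l s] ms by (simp add: add_divide_distrib)
  also have "g x1 + g x2 + g x3 = 4 * e1 * e2 - e1^3"
    unfolding g_def e1_def e2_def by (simp add: algebra_simps power2_eq_square power3_eq_cube)
  also have "\<dots> / e3 = b1^3 / (a0 * b2^2) - 4 * w"
    unfolding X w using e3 by (simp add: field_simps)
  finally show "mult_sigma 1 \<psi> + 6 = b1^3 / (a0 * b2^2) - 4 * w" .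
  have "mult_sigma 2 \<psi> + 2 * mult_sigma 1 \<psi>
      = (g x1 * g x2 + g x1 * g x3 + g x2 * g x3) / e3^2 - 2 * ((g x1 + g x2 + g x3) / e3)"
    unfolding mult_sigma_split[OF l s] ms using e3
    by (simp add: field_simps power2_eq_square)
  also have "\<dots> = ((g x1 * g x2 + g x1 * g x3 + g x2 * g x3) - 2 * e3 * (g x1 + g x2 + g x3)) / e3^2"
    using e3 by (simp add: field_simps power2_eq_square)
  also have "(g x1 * g x2 + g x1 * g x3 + g x2 * g x3) - 2 * e3 * (g x1 + g x2 + g x3)
      = 4 * e2^3 - 2 * e1 * e2 * e3 - (e1 * e2)^2"
    unfolding g_def e1_def e2_def e3_def
    by (simp add: algebra_simps power2_eq_square power3_eq_cube)
  also have "\<dots> / e3^2 = 2 * w - w^2 + 4 * c"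
    unfolding w c using e3 by (simp add: field_simps power2_eq_square)
  finally show "mult_sigma 2 \<psi> + 2 * mult_sigma 1 \<psi> = 2 * w - w^2 + 4 * c" .
qed

lemma critical_point_critical_family:
  assumes "a0 \<noteq> 0" "b2 \<noteq> 0"
  shows "critical_point (critical_family a0 b0 b1 b2) Infty"
proof -
  have "wronskian [:a0:] [:b0, b1, b2:] (1, 0) = 0"
    by (simp add: wronskian_def eval_nat_numeral)
  thus ?thesis
    using critical_point_lift[OF is_lift_critical_family[OF assms], of "(1, 0)"]
    by (simp add: proj_point_def)
qed

lemma C_iff:
  assumes "n \<ge> 2"
  shows "(s1, s2) \<in> C n \<longleftrightarrow> (\<exists>a0 b0 b1 b2. a0 \<noteq> 0 \<and> b2 \<noteq> 0 \<and>
     exact_period (critical_family a0 b0 b1 b2) Infty n \<and>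
     s1 = mult_sigma 1 (critical_family a0 b0 b1 b2) \<and>
     s2 = mult_sigma 2 (critical_family a0 b0 b1 b2))" (is "_ \<longleftrightarrow> ?R")
proof
  assume "(s1, s2) \<in> C n"
  then obtain \<phi> P where \<phi>: "rf_degree \<phi> = 2" "critical_point \<phi> P" "exact_period \<phi> P n"
    and "(s1, s2) = moduli_coords (conj_class \<phi>)"
    unfolding C_def by blast
  hence s: "s1 = mult_sigma 1 \<phi>" "s2 = mult_sigma 2 \<phi>"
    by (simp_all add: moduli_coords_conj_class)
  have "(rf_eval \<phi> ^^ 1) P \<noteq> P"
    using \<phi>(3) assms unfolding exact_period_def by (metis One_nat_def Suc_1 Suc_le_lessD zero_less_one)
  hence "rf_eval \<phi> P \<noteq> P" by simp
  from critical_normal_form[OF \<phi>(1,2) this] show ?R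
    using \<phi>(3) s by metis
next
  assume ?R
  then obtain a0 b0 b1 b2 where ab: "a0 \<noteq> 0" "b2 \<noteq> 0"
    "exact_period (critical_family a0 b0 b1 b2) Infty n"
    "s1 = mult_sigma 1 (critical_family a0 b0 b1 b2)"
    "s2 = mult_sigma 2 (critical_family a0 b0 b1 b2)" by blast
  define \<psi> where "\<psi> = critical_family a0 b0 b1 b2"
  have deg: "rf_degree \<psi> = 2"
    unfolding \<psi>_def by (rule is_lift_degree[OF is_lift_critical_family[OF ab(1,2)]])
  have "(s1, s2) = moduli_coords (conj_class \<psi>)"
    unfolding ab(4,5) \<psi>_def[symmetric]
    by (rule moduli_coords_conj_class[OF deg, symmetric])
  moreover have "critical_point \<psi> Infty \<and> exact_period \<psi> Infty n"
    using critical_point_critical_family[OF ab(1,2)] ab(3) by (simp add: \<psi>_def)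
  ultimately show "(s1, s2) \<in> C n"
    unfolding C_def using deg by blast
qed

text \<open>
  The orbit of \<open>\<infinity>\<close> starts \<open>\<infinity> \<mapsto> 0 \<mapsto> (a0 : b0) \<mapsto> (a0 b0\<^sup>2 : S)\<close>, and a point is \<open>\<infinity>\<close> iff its
  second coordinate vanishes.
\<close>

lemma exact_period_critical_family:
  fixes a0 b0 b1 b2 :: qbar
  assumes "a0 \<noteq> 0" "b2 \<noteq> 0"
  defines "\<psi> \<equiv> critical_family a0 b0 b1 b2"
  defines "S \<equiv> b2 * a0^2 + b1 * a0 * b0 + b0^3"
  shows "exact_period \<psi> Infty 2 \<longleftrightarrow> b0 = 0"
    and "exact_period \<psi> Infty 3 \<longleftrightarrow> b0 \<noteq> 0 \<and> S = 0"
    and "exact_period \<psi> Infty 4 \<longleftrightarrow> b0 \<noteq> 0 \<and> S \<noteq> 0 \<and>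
           b2 * (a0 * b0^2)^2 + b1 * (a0 * b0^2) * S + b0 * S^2 = 0"
proof -
  define p q where "p = [:a0:]" and "q = [:b0, b1, b2:]"
  have l: "is_lift \<psi> p q"
    unfolding \<psi>_def p_def q_def by (rule is_lift_critical_family[OF assms(1,2)])
  have ev: "rf_eval \<psi> (proj_point (x, y)) = proj_point (a0 * y^2, b2 * x^2 + b1 * (x * y) + b0 * y^2)"
    if "(x, y) \<noteq> (0, 0)" for x y
    using rf_eval_lift[OF l that] unfolding p_def q_def lift_map_critical_family .
  have nz: "(a0 * y^2, b2 * x^2 + b1 * (x * y) + b0 * y^2) \<noteq> (0, 0)" if "(x, y) \<noteq> (0, 0)" for x y
    using lift_map_nonzero[OF l that] unfolding p_def q_def lift_map_critical_family .
  have S: "b2 * a0^2 + b1 * (a0 * b0) + b0 * b0^2 = S"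
    by (simp add: S_def eval_nat_numeral)
  have p0: "Infty = proj_point (1, 0)" by (simp add: proj_point_def)
  have p1: "rf_eval \<psi> Infty = proj_point (0, 1)"
    unfolding p0 using assms(1,2) by (subst ev) (simp_all add: proj_point_def)
  have p2: "rf_eval \<psi> (proj_point (0, 1)) = proj_point (a0, b0)"
    by (subst ev) simp_all
  have p3: "rf_eval \<psi> (proj_point (a0, b0)) = proj_point (a0 * b0^2, S)"
    unfolding S[symmetric] using assms(1) by (subst ev) simp_all
  have "(a0 * b0^2, S) \<noteq> (0, 0)"
    unfolding S[symmetric] using assms(1) by (intro nz) simp
  hence p4: "rf_eval \<psi> (proj_point (a0 * b0^2, S))
      = proj_point (a0 * S^2, b2 * (a0 * b0^2)^2 + b1 * (a0 * b0^2 * S) + b0 * S^2)"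
    by (rule ev)
  have it: "(rf_eval \<psi> ^^ 1) Infty = proj_point (0, 1)"
    "(rf_eval \<psi> ^^ 2) Infty = proj_point (a0, b0)"
    "(rf_eval \<psi> ^^ 3) Infty = proj_point (a0 * b0^2, S)"
    "(rf_eval \<psi> ^^ 4) Infty
       = proj_point (a0 * S^2, b2 * (a0 * b0^2)^2 + b1 * (a0 * b0^2 * S) + b0 * S^2)"
    by (simp_all add: eval_nat_numeral p1 p2 p3[unfolded eval_nat_numeral, simplified]
        p4[unfolded eval_nat_numeral, simplified])
  have inf: "proj_point (x, y) = Infty \<longleftrightarrow> y = 0" for x y by (simp add: proj_point_def)
  have b: "(\<forall>m. 0 < m \<and> m < 2 \<longrightarrow> Q m) \<longleftrightarrow> Q 1"
    "(\<forall>m. 0 < m \<and> m < 3 \<longrightarrow> Q m) \<longleftrightarrow> Q 1 \<and> Q 2"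
    "(\<forall>m. 0 < m \<and> m < 4 \<longrightarrow> Q m) \<longleftrightarrow> Q 1 \<and> Q 2 \<and> Q 3" for Q :: "nat \<Rightarrow> bool"
  proof -
    have "0 < m \<and> m < 2 \<longleftrightarrow> m = 1" "0 < m \<and> m < 3 \<longleftrightarrow> m = 1 \<or> m = 2"
      "0 < m \<and> m < 4 \<longleftrightarrow> m = 1 \<or> m = 2 \<or> m = 3" for m :: nat by auto
    thus "(\<forall>m. 0 < m \<and> m < 2 \<longrightarrow> Q m) \<longleftrightarrow> Q 1"
      "(\<forall>m. 0 < m \<and> m < 3 \<longrightarrow> Q m) \<longleftrightarrow> Q 1 \<and> Q 2"
      "(\<forall>m. 0 < m \<and> m < 4 \<longrightarrow> Q m) \<longleftrightarrow> Q 1 \<and> Q 2 \<and> Q 3" by auto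
  qed
  show "exact_period \<psi> Infty 2 \<longleftrightarrow> b0 = 0"
    unfolding exact_period_def b it inf by simp
  show "exact_period \<psi> Infty 3 \<longleftrightarrow> b0 \<noteq> 0 \<and> S = 0"
    unfolding exact_period_def b it inf by auto
  show "exact_period \<psi> Infty 4 \<longleftrightarrow> b0 \<noteq> 0 \<and> S \<noteq> 0 \<and>
           b2 * (a0 * b0^2)^2 + b1 * (a0 * b0^2) * S + b0 * S^2 = 0"
    unfolding exact_period_def b it inf by (auto simp: mult.assoc)
qed

section \<open>Two affine parameters on the critical family\<close>

text \<open>
  The relation between the parameters \<open>(w, c)\<close> of a map \<open>\<infinity> \<mapsto> 0\<close> with critical point \<open>\<infinity>\<close> and the
  coordinates \<open>(\<sigma>\<^sub>1, \<sigma>\<^sub>2)\<close> of its class. It is stated over an arbitrary field so that it can be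
  transported between the rationals and their closure.
\<close>

definition moduli_param :: "'a::field \<Rightarrow> 'a \<Rightarrow> 'a \<Rightarrow> 'a \<Rightarrow> bool" where
  "moduli_param w c s1 s2 \<longleftrightarrow> c \<noteq> 0 \<and> s1 + 6 = w^3 / c - 4 * w \<and> s2 + 2 * s1 = 2 * w - w^2 + 4 * c"

text \<open>
  For \<open>b\<^sub>0 = 0\<close> both \<open>w\<close> and \<open>c\<close> vanish, which leaves \<open>\<sigma>\<^sub>2 + 2\<sigma>\<^sub>1 = 0\<close>, while
  \<open>\<sigma>\<^sub>1 + 6 = b\<^sub>1\<^sup>3 / (a\<^sub>0 b\<^sub>2\<^sup>2)\<close> takes all values.
\<close>

lemma C_2_iff: "(s1, s2) \<in> C 2 \<longleftrightarrow> s2 = - 2 * s1"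
proof
  assume "(s1, s2) \<in> C 2"
  then obtain a0 b0 b1 b2 where ab: "a0 \<noteq> 0" "b2 \<noteq> 0"
    "exact_period (critical_family a0 b0 b1 b2) Infty 2"
    "s1 = mult_sigma 1 (critical_family a0 b0 b1 b2)"
    "s2 = mult_sigma 2 (critical_family a0 b0 b1 b2)"
    unfolding C_iff[OF order.refl] by blast
  have "b0 = 0" using ab(3) exact_period_critical_family(1)[OF ab(1,2)] by simp
  hence "s2 + 2 * s1 = 0"
    using mult_sigma_critical_family(2)[OF ab(1,2), of b0 b1] unfolding ab(4,5) by simp
  thus "s2 = - 2 * s1" by (simp add: add_eq_0_iff)
next
  assume s2: "s2 = - 2 * s1"
  have "\<exists>a0 b1 :: qbar. a0 \<noteq> 0 \<and> s1 + 6 = b1^3 / a0"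
  proof (cases "s1 + 6 = 0")
    case True
    thus ?thesis by (intro exI[of _ 1] exI[of _ 0]) simp
  next
    case False
    (* u^3 / u^2 = u for u = s1 + 6. *)
    thus ?thesis
      by (intro exI[of _ "(s1 + 6)^2"] exI[of _ "s1 + 6"]) (simp add: power2_eq_square power3_eq_cube)
  qed
  then obtain a0 b1 where ab: "a0 \<noteq> 0" "s1 + 6 = b1^3 / a0" by blast
  note ms = mult_sigma_critical_family[OF ab(1) one_neq_zero, of 0 b1]
  define \<psi> where "\<psi> = critical_family a0 0 b1 1"
  have "mult_sigma 1 \<psi> + 6 = s1 + 6"
    using ms(1) unfolding ab(2) \<psi>_def[symmetric] by simp
  hence s1: "s1 = mult_sigma 1 \<psi>" by (simp only: add_right_cancel)
  have "mult_sigma 2 \<psi> + 2 * mult_sigma 1 \<psi> = 0"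
    using ms(2) unfolding \<psi>_def[symmetric] by simp
  hence "s2 = mult_sigma 2 \<psi>"
    unfolding s2 s1 by (simp add: add_eq_0_iff)
  moreover have "exact_period \<psi> Infty 2"
    unfolding \<psi>_def exact_period_critical_family(1)[OF ab(1) one_neq_zero] ..
  ultimately show "(s1, s2) \<in> C 2"
    unfolding C_iff[OF order.refl] using ab(1) one_neq_zero s1 unfolding \<psi>_def by blast
qed

text \<open>
  With \<open>D = b\<^sub>2 a\<^sub>0\<^sup>2\<close> one has \<open>b\<^sub>0\<^sup>3 = D c\<close> and \<open>a\<^sub>0 b\<^sub>0 b\<^sub>1 = D w\<close>, so the conditions on the orbit become
  inhomogeneous polynomials in \<open>w\<close> and \<open>c\<close>.
\<close>

lemma critical_family_param:
  fixes a0 b0 b1 b2 :: qbar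
  assumes "a0 \<noteq> 0" "b2 \<noteq> 0" "b0 \<noteq> 0"
  defines "w \<equiv> b1 * b0 / (b2 * a0)" and "c \<equiv> b0^3 / (b2 * a0^2)"
  defines "\<psi> \<equiv> critical_family a0 b0 b1 b2"
  shows "moduli_param w c (mult_sigma 1 \<psi>) (mult_sigma 2 \<psi>)"
    and "exact_period \<psi> Infty 3 \<longleftrightarrow> 1 + w + c = 0"
    and "exact_period \<psi> Infty 4 \<longleftrightarrow> 1 + w + c \<noteq> 0 \<and> c + w * (1 + w + c) + (1 + w + c)^2 = 0"
proof -
  define D where "D = b2 * a0^2"
  have D: "D \<noteq> 0" using assms(1,2) by (simp add: D_def)
  have Dw: "b1 * a0 * b0 = D * w" and Dc: "b0^3 = D * c"
    unfolding D_def w_def c_def using assms(1,2) by (simp_all add: power2_eq_square)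
  have X: "b1^3 / (a0 * b2^2) = w^3 / c" and c: "c \<noteq> 0"
    unfolding w_def c_def using assms(1-3) by (simp_all add: field_simps power2_eq_square power3_eq_cube)
  note ms = mult_sigma_critical_family[OF assms(1,2), of b0 b1, folded w_def c_def \<psi>_def]
  show "moduli_param w c (mult_sigma 1 \<psi>) (mult_sigma 2 \<psi>)"
    unfolding moduli_param_def using c ms unfolding X by blast
  define S where "S = b2 * a0^2 + b1 * a0 * b0 + b0^3"
  have S: "S = D * (1 + w + c)"
    unfolding S_def Dw Dc by (simp add: D_def algebra_simps)
  have "b2 * (a0 * b0^2)^2 + b1 * (a0 * b0^2) * S + b0 * S^2
      = b0 * (D * b0^3 + (b1 * a0 * b0) * S + S^2)"
    by (simp add: D_def algebra_simps power2_eq_square power3_eq_cube)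
  also have "\<dots> = b0 * D^2 * (c + w * (1 + w + c) + (1 + w + c)^2)"
    unfolding Dw Dc S by (simp add: algebra_simps power2_eq_square)
  finally have R: "b2 * (a0 * b0^2)^2 + b1 * (a0 * b0^2) * S + b0 * S^2 = 0
      \<longleftrightarrow> c + w * (1 + w + c) + (1 + w + c)^2 = 0"
    using D assms(3) by simp
  have S0: "S = 0 \<longleftrightarrow> 1 + w + c = 0" unfolding S using D by simp
  show "exact_period \<psi> Infty 3 \<longleftrightarrow> 1 + w + c = 0"
    unfolding \<psi>_def exact_period_critical_family(2)[OF assms(1,2)] S_def[symmetric] S0
    using assms(3) by simp
  show "exact_period \<psi> Infty 4 \<longleftrightarrow> 1 + w + c \<noteq> 0 \<and> c + w * (1 + w + c) + (1 + w + c)^2 = 0"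
    unfolding \<psi>_def exact_period_critical_family(3)[OF assms(1,2)] S_def[symmetric] S0 R
    using assms(3) by simp
qed

lemma critical_family_of_param:
  assumes "moduli_param w c s1 s2"
  obtains a0 b0 b1 b2 where "a0 \<noteq> 0" "b2 \<noteq> 0" "b0 \<noteq> 0" "w = b1 * b0 / (b2 * a0)"
    "c = b0^3 / (b2 * a0^2)" "s1 = mult_sigma 1 (critical_family a0 b0 b1 b2)"
    "s2 = mult_sigma 2 (critical_family a0 b0 b1 b2)"
proof -
  note m = assms[unfolded moduli_param_def]
  have nz: "(1::qbar) \<noteq> 0" "1 / c \<noteq> 0" using m by simp_all
  have wc: "w = (w / c) * 1 / (1 / c * 1)" "c = 1^3 / (1 / c * 1^2)" using m by simp_all
  define \<psi> where "\<psi> = critical_family 1 1 (w / c) (1 / c)"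
  have "moduli_param w c (mult_sigma 1 \<psi>) (mult_sigma 2 \<psi>)"
    using critical_family_param(1)[OF nz nz(1), of "w / c", folded wc] unfolding \<psi>_def .
  note m' = this[unfolded moduli_param_def]
  have "s1 + 6 = mult_sigma 1 \<psi> + 6" using m m' by metis
  hence s1: "s1 = mult_sigma 1 \<psi>" by simp
  have "s2 + 2 * s1 = mult_sigma 2 \<psi> + 2 * mult_sigma 1 \<psi>" using m m' by metis
  hence s2: "s2 = mult_sigma 2 \<psi>" by (simp add: s1)
  show ?thesis
    by (rule that[OF nz nz(1) wc s1[unfolded \<psi>_def] s2[unfolded \<psi>_def]])
qed

lemma C_3_iff: "(s1, s2) \<in> C 3 \<longleftrightarrow> (\<exists>w c. moduli_param w c s1 s2 \<and> 1 + w + c = 0)"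
proof
  have n: "(2::nat) \<le> 3" by simp
  show "\<exists>w c. moduli_param w c s1 s2 \<and> 1 + w + c = 0" if L: "(s1, s2) \<in> C 3"
  proof -
    obtain a0 b0 b1 b2 where ab: "a0 \<noteq> 0" "b2 \<noteq> 0"
      "exact_period (critical_family a0 b0 b1 b2) Infty 3"
      "s1 = mult_sigma 1 (critical_family a0 b0 b1 b2)"
      "s2 = mult_sigma 2 (critical_family a0 b0 b1 b2)"
      using L unfolding C_iff[OF n] by blast
    have "b0 \<noteq> 0" using ab(3) exact_period_critical_family(2)[OF ab(1,2)] by simp
    note par = critical_family_param[OF ab(1,2) this, of b1]
    show ?thesis using par(1) par(2) ab(3-5) by blast
  qed
  show "(s1, s2) \<in> C 3" if R: "\<exists>w c. moduli_param w c s1 s2 \<and> 1 + w + c = 0"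
  proof -
    obtain w c where wc: "moduli_param w c s1 s2" "1 + w + c = 0" using R by blast
    obtain a0 b0 b1 b2 where ab: "a0 \<noteq> 0" "b2 \<noteq> 0" "b0 \<noteq> 0" "w = b1 * b0 / (b2 * a0)"
      "c = b0^3 / (b2 * a0^2)" "s1 = mult_sigma 1 (critical_family a0 b0 b1 b2)"
      "s2 = mult_sigma 2 (critical_family a0 b0 b1 b2)"
      using critical_family_of_param[OF wc(1)] .
    have "exact_period (critical_family a0 b0 b1 b2) Infty 3"
      using critical_family_param(2)[OF ab(1-3), of b1] wc(2) ab(4,5) by simp
    thus ?thesis unfolding C_iff[OF n] using ab by blast
  qed
qed

lemma C_4_iff: "(s1, s2) \<in> C 4 \<longleftrightarrow> (\<exists>w c. moduli_param w c s1 s2 \<and> 1 + w + c \<noteq> 0 \<and>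
   c + w * (1 + w + c) + (1 + w + c)^2 = 0)"
proof
  have n: "(2::nat) \<le> 4" by simp
  show "\<exists>w c. moduli_param w c s1 s2 \<and> 1 + w + c \<noteq> 0 \<and> c + w * (1 + w + c) + (1 + w + c)^2 = 0"
    if L: "(s1, s2) \<in> C 4"
  proof -
    obtain a0 b0 b1 b2 where ab: "a0 \<noteq> 0" "b2 \<noteq> 0"
      "exact_period (critical_family a0 b0 b1 b2) Infty 4"
      "s1 = mult_sigma 1 (critical_family a0 b0 b1 b2)"
      "s2 = mult_sigma 2 (critical_family a0 b0 b1 b2)"
      using L unfolding C_iff[OF n] by blast
    have "b0 \<noteq> 0" using ab(3) exact_period_critical_family(3)[OF ab(1,2)] by simp
    note par = critical_family_param[OF ab(1,2) this, of b1]
    show ?thesis using par(1) par(3) ab(3-5) by blast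
  qed
  show "(s1, s2) \<in> C 4" if R: "\<exists>w c. moduli_param w c s1 s2 \<and> 1 + w + c \<noteq> 0 \<and>
      c + w * (1 + w + c) + (1 + w + c)^2 = 0"
  proof -
    obtain w c where wc: "moduli_param w c s1 s2" "1 + w + c \<noteq> 0"
      "c + w * (1 + w + c) + (1 + w + c)^2 = 0" using R by blast
    obtain a0 b0 b1 b2 where ab: "a0 \<noteq> 0" "b2 \<noteq> 0" "b0 \<noteq> 0" "w = b1 * b0 / (b2 * a0)"
      "c = b0^3 / (b2 * a0^2)" "s1 = mult_sigma 1 (critical_family a0 b0 b1 b2)"
      "s2 = mult_sigma 2 (critical_family a0 b0 b1 b2)"
      using critical_family_of_param[OF wc(1)] .
    have "exact_period (critical_family a0 b0 b1 b2) Infty 4"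
      using critical_family_param(3)[OF ab(1-3), of b1] wc(2,3) unfolding ab(4,5) by blast
    thus ?thesis unfolding C_iff[OF n] using ab by blast
  qed
qed

section \<open>Rational points\<close>

text \<open>
  Elimination of \<open>c\<close>. In general the two roots belong to the two critical points of the map. The shift
  \<open>r = w + 2\<close> removes the cubic term from the equation for period four that is used later.
\<close>

lemma moduli_param_quadratic:
  fixes w c s1 s2 :: "'a::field"
  assumes "moduli_param w c s1 s2"
  defines "x \<equiv> s1 + 6" and "y \<equiv> s2 + 2 * s1" and "r \<equiv> w + 2"
  shows "(x - 8) * r^2 + (4 * y - 6 * x + 32) * r + (x * y + 8 * x - 8 * y - 32) = 0"
proof -
  have c: "c \<noteq> 0" and x: "x = w^3 / c - 4 * w" and y: "y = 2 * w - w^2 + 4 * c"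
    using assms(1) unfolding moduli_param_def x_def y_def by blast+
  have Xc: "x * c = w^3 - 4 * w * c"
    unfolding x using c by (simp add: field_simps)
  have "c * ((x - 8) * r^2 + (4 * y - 6 * x + 32) * r + (x * y + 8 * x - 8 * y - 32))
      = (x * c - 8 * c) * r^2 + (4 * y * c - 6 * (x * c) + 32 * c) * r
        + ((x * c) * y + 8 * (x * c) - 8 * y * c - 32 * c)"
    by (simp add: algebra_simps)
  also have "\<dots> = 0"
    unfolding Xc y r_def by (simp add: algebra_simps power2_eq_square power3_eq_cube)
  finally show ?thesis using c by simp
qed

lemma irrational_linear_relation:
  fixes r :: "'a::field_char_0"
  assumes "r \<notin> \<rat>" "a \<in> \<rat>" "b \<in> \<rat>" "a * r + b = 0"
  shows "a = 0" "b = 0"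
proof -
  show "a = 0"
  proof (rule ccontr)
    assume "a \<noteq> 0"
    hence "r = - b / a" using assms(4) by (simp add: field_simps add_eq_0_iff)
    thus False using assms(1-3) by auto
  qed
  thus "b = 0" using assms(4) by simp
qed

text \<open>
  Let \<open>r = w + 2\<close>, \<open>x = \<sigma>\<^sub>1 + 6\<close> and \<open>y = \<sigma>\<^sub>2 + 2\<sigma>\<^sub>1\<close>. The period condition yields \<open>r\<^sup>2 = 2r - 4 - y\<close>. If \<open>r\<close> is irrational, substituting this in the
  quadratic equation gives a linear relation whose coefficients must vanish, so that \<open>x = 0\<close> and
  \<open>y = -4\<close>; but then \<open>r\<^sup>2 = 2r\<close>.
\<close>

lemma period_3_param_rational:
  fixes w c s1 s2 :: "'a::field_char_0"
  assumes "moduli_param w c s1 s2" "1 + w + c = 0" "s1 \<in> \<rat>" "s2 \<in> \<rat>"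
  shows "w \<in> \<rat>"
proof (rule ccontr)
  assume "w \<notin> \<rat>"
  define x y r where "x = s1 + 6" and "y = s2 + 2 * s1" and "r = w + 2"
  have r: "r \<notin> \<rat>"
  proof
    assume "r \<in> \<rat>"
    hence "r - 2 \<in> \<rat>" by simp
    thus False using \<open>w \<notin> \<rat>\<close> by (simp add: r_def)
  qed
  have rat: "x \<in> \<rat>" "y \<in> \<rat>" unfolding x_def y_def using assms(3,4) by simp_all
  have c: "c = - 1 - w" using assms(2) by (simp add: eq_neg_iff_add_eq_0 algebra_simps)
  have y: "y = 2 * w - w^2 + 4 * c"
    using assms(1) unfolding moduli_param_def y_def by blast
  have r2: "r^2 = 2 * r - 4 - y"
    unfolding y r_def unfolding c by (simp add: algebra_simps power2_eq_square)
  have "(x - 8) * r^2 + (4 * y - 6 * x + 32) * r + (x * y + 8 * x - 8 * y - 32) = 0"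
    unfolding x_def y_def r_def by (rule moduli_param_quadratic[OF assms(1)])
  hence "(4 * y - 4 * x + 16) * r + 4 * x = 0"
    unfolding r2 by (simp add: algebra_simps)
  moreover have "4 * y - 4 * x + 16 \<in> \<rat>" "4 * x \<in> \<rat>" using rat by simp_all
  ultimately have "4 * y - 4 * x + 16 = 0" "4 * x = 0"
    using irrational_linear_relation[OF r] by blast+
  hence "x = 0" "4 * (y + 4) = 0" by simp_all
  hence "y + 4 = 0" by (simp only: mult_eq_0_iff) simp
  hence "y = - 4" by (simp only: eq_neg_iff_add_eq_0)
  hence "r * (r - 2) = 0" using r2 by (simp add: algebra_simps power2_eq_square)
  hence "r = 0 \<or> r = 2" by simp
  thus False using r by auto
qed

text \<open>
  A rational root of a monic integer polynomial is an integer; here it divides the constant term \<open>1\<close>,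
  and \<open>\<plusminus>1\<close> are not roots.
\<close>

lemma no_rational_root:
  fixes m :: "'a::field_char_0"
  assumes "m \<in> \<rat>"
  shows "1 + 4 * m + 8 * m^2 + 7 * m^3 + 4 * m^4 - 9 * m^6 + m^9 \<noteq> 0"
proof
  assume root: "1 + 4 * m + 8 * m^2 + 7 * m^3 + 4 * m^4 - 9 * m^6 + m^9 = 0"
  define p :: "'a poly" where "p = [:1, 4, 8, 7, 4, 0, - 9, 0, 0, 1:]"
  have "poly p m = 0"
    using root by (simp add: p_def algebra_simps eval_nat_numeral)
  moreover have "lead_coeff p = 1" by (simp add: p_def)
  moreover have "coeff p i \<in> \<int>" for i
    by (simp add: p_def coeff_pCons split: nat.splits)
  ultimately have "algebraic_int m" by (intro algebraic_int.intros) auto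
  hence "m \<in> \<int>" using assms by (rule rational_algebraic_int_is_int)
  then obtain k where k: "m = of_int k" by (elim Ints_cases)
  have "of_int (1 + 4 * k + 8 * k^2 + 7 * k^3 + 4 * k^4 - 9 * k^6 + k^9) = (of_int 0 :: 'a)"
    using root unfolding k by simp
  hence "1 + 4 * k + 8 * k^2 + 7 * k^3 + 4 * k^4 - 9 * k^6 + k^9 = 0"
    by (simp only: of_int_eq_iff)
  hence e: "1 = k * (- 4 - 8 * k - 7 * k^2 - 4 * k^3 + 9 * k^5 - k^8)"
    by (simp add: algebra_simps eval_nat_numeral)
  hence "k dvd 1" by (rule dvdI)
  hence "k = 1 \<or> k = - 1" by auto
  thus False using e by auto
qed

text \<open>
  With \<open>r\<close>, \<open>x\<close>, \<open>y\<close> as for period three, the period condition becomes \<open>(r\<^sup>2 + y)\<^sup>2 - 8r + 4y + 16 = 0\<close>. For irrational \<open>r\<close> the quadratic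
  equation reads \<open>r\<^sup>2 = S r + D - y\<close> with rational \<open>S\<close> and \<open>D\<close>; reducing the quartic by it gives two
  equations in \<open>S\<close>, \<open>D\<close>, \<open>y\<close>, and a third one comes from the definition of \<open>S\<close> and \<open>D\<close> by the two
  parameters \<open>x\<close>, \<open>y\<close>. Eliminating \<open>D\<close> and \<open>y\<close> leaves a polynomial equation for \<open>S/2\<close>.
\<close>

lemma period_4_param_rational:
  fixes w c s1 s2 :: "'a::field_char_0"
  assumes "moduli_param w c s1 s2" "c + w * (1 + w + c) + (1 + w + c)^2 = 0"
    "s1 \<in> \<rat>" "s2 \<in> \<rat>"
  shows "w \<in> \<rat>"
proof (rule ccontr)
  assume "w \<notin> \<rat>"
  define x y r where "x = s1 + 6" and "y = s2 + 2 * s1" and "r = w + 2"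
  have r: "r \<notin> \<rat>"
  proof
    assume "r \<in> \<rat>"
    hence "r - 2 \<in> \<rat>" by simp
    thus False using \<open>w \<notin> \<rat>\<close> by (simp add: r_def)
  qed
  have rat: "x \<in> \<rat>" "y \<in> \<rat>" unfolding x_def y_def using assms(3,4) by simp_all
  have y: "y = 2 * w - w^2 + 4 * c"
    using assms(1) unfolding moduli_param_def y_def by blast
  have "(r^2 + y)^2 - 8 * r + 4 * y + 16 = 16 * (c + w * (1 + w + c) + (1 + w + c)^2)"
    unfolding y r_def by (simp add: algebra_simps power2_eq_square)
  hence quartic: "(r^2 + y)^2 - 8 * r + 4 * y + 16 = 0"
    unfolding assms(2) by simp
  have quad: "(x - 8) * r^2 + (4 * y - 6 * x + 32) * r + (x * y + 8 * x - 8 * y - 32) = 0"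
    unfolding x_def y_def r_def by (rule moduli_param_quadratic[OF assms(1)])
  define Z where "Z = x - 8"
  have ZX: "x = Z + 8" by (simp add: Z_def)
  have ratZ: "Z \<in> \<rat>" unfolding Z_def using rat by simp
  have quad': "Z * r^2 + (4 * (y - 4) - 6 * Z) * r + (Z * (y + 8) + 32) = 0"
    using quad unfolding ZX by (simp add: algebra_simps)
  (* The quadratic equation could degenerate only to the contradictory 32 = 0. *)
  have Z0: "Z \<noteq> 0"
  proof
    assume "Z = 0"
    hence "(4 * (y - 4)) * r + 32 = 0" using quad' by simp
    moreover have "4 * (y - 4) \<in> \<rat>" "(32 :: 'a) \<in> \<rat>" using rat by simp_all
    ultimately have "(32 :: 'a) = 0" using irrational_linear_relation(2)[OF r] by blast
    thus False by simp
  qed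
  define S D where "S = 6 - 4 * (y - 4) / Z" and "D = - 8 - 32 / Z"
  have ratSD: "S \<in> \<rat>" "D \<in> \<rat>" unfolding S_def D_def using rat ratZ by simp_all
  have r2: "r^2 = S * r + D - y"
  proof -
    have ZS: "Z * S = 6 * Z - 4 * (y - 4)" and ZD: "Z * D = - 8 * Z - 32"
      unfolding S_def D_def right_diff_distrib using Z0 by simp_all
    have "Z * (r^2 - (S * r + D - y)) = Z * r^2 - (Z * S) * r - Z * D + Z * y"
      by (simp add: algebra_simps)
    also have "\<dots> = Z * r^2 + (4 * (y - 4) - 6 * Z) * r + (Z * (y + 8) + 32)"
      unfolding ZS ZD by (simp add: algebra_simps)
    also have "\<dots> = 0" by (rule quad')
    finally show ?thesis using Z0 by simp
  qed
  have "(S^3 + 2 * S * D - 8) * r + (S^2 * (D - y) + D^2 + 4 * y + 16) = 0"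
  proof -
    have "(S * r + D)^2 = S^2 * r^2 + 2 * S * D * r + D^2"
      by (simp add: algebra_simps power2_eq_square)
    also have "\<dots> = (S^3 + 2 * S * D) * r + S^2 * (D - y) + D^2"
      unfolding r2 by (simp add: algebra_simps power2_eq_square power3_eq_cube)
    finally have sq: "(S * r + D)^2 = (S^3 + 2 * S * D) * r + S^2 * (D - y) + D^2" .
    have "r^2 + y = S * r + D" unfolding r2 by simp
    hence "(S^3 + 2 * S * D) * r + S^2 * (D - y) + D^2 - 8 * r + 4 * y + 16 = 0"
      using quartic by (simp only: sq)
    thus ?thesis by (simp add: algebra_simps)
  qed
  moreover have "S^3 + 2 * S * D - 8 \<in> \<rat>" "S^2 * (D - y) + D^2 + 4 * y + 16 \<in> \<rat>"
    using ratSD rat by simp_all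
  ultimately have i: "S^3 + 2 * S * D - 8 = 0" and ii: "S^2 * (D - y) + D^2 + 4 * y + 16 = 0"
    using irrational_linear_relation[OF r] by blast+
  have iii: "(y - 4) * (D + 8) = 8 * (S - 6)"
    unfolding S_def D_def using Z0 by (simp add: field_simps)
  define m where "m = S / 2"
  have S: "S = 2 * m" by (simp add: m_def)
  have ratm: "m \<in> \<rat>" unfolding m_def using ratSD by simp
  have "4 * (m * D) = 4 * (2 - 2 * m^3)"
    using i unfolding S by (simp add: algebra_simps power2_eq_square power3_eq_cube)
  hence mD: "m * D = 2 - 2 * m^3"
    by (subst (asm) mult_left_cancel) simp_all
  have "2 * ((y - 4) * (1 + 4 * m - m^3)) = (y - 4) * (m * D + 8 * m)"
    unfolding mD by (simp add: algebra_simps)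
  also have "\<dots> = m * ((y - 4) * (D + 8))" by (simp add: algebra_simps)
  also have "\<dots> = 2 * (8 * m * (m - 3))" unfolding iii S by (simp add: algebra_simps)
  finally have "(y - 4) * (1 + 4 * m - m^3) = 8 * m * (m - 3)" by simp
  hence YK: "y * (1 + 4 * m - m^3) = 4 - 8 * m + 8 * m^2 - 4 * m^3"
    by (simp add: algebra_simps power2_eq_square)
  have "0 = m^2 * (S^2 * (D - y) + D^2 + 4 * y + 16)" unfolding ii by simp
  also have "\<dots> = 4 * m^3 * (m * D) + (m * D)^2 + 4 * m^2 * (1 - m^2) * y + 16 * m^2"
    unfolding S by (simp add: algebra_simps power2_eq_square power3_eq_cube)
  also have "\<dots> = 4 * (m^2 * (1 - m^2) * y + 1 - m^6 + 4 * m^2)"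
    unfolding mD by (simp add: algebra_simps eval_nat_numeral)
  finally have "m^2 * (1 - m^2) * y + 1 - m^6 + 4 * m^2 = 0"
    by (subst (asm) eq_commute, subst (asm) mult_eq_0_iff) simp
  hence "0 = (m^2 * (1 - m^2) * y + 1 - m^6 + 4 * m^2) * (1 + 4 * m - m^3)" by simp
  also have "\<dots> = m^2 * (1 - m^2) * (y * (1 + 4 * m - m^3)) + (1 - m^6 + 4 * m^2) * (1 + 4 * m - m^3)"
    by (simp add: algebra_simps)
  also have "\<dots> = 1 + 4 * m + 8 * m^2 + 7 * m^3 + 4 * m^4 - 9 * m^6 + m^9"
    unfolding YK by (simp add: algebra_simps eval_nat_numeral)
  finally show False using no_rational_root[OF ratm] by simp
qed

lemma moduli_param_of_rat:
  "moduli_param (of_rat w) (of_rat c) (of_rat a) (of_rat b :: 'a::field_char_0)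
     \<longleftrightarrow> moduli_param w c a b"
proof -
  have "of_rat a + 6 = (of_rat w^3 / of_rat c - 4 * of_rat w :: 'a)
      \<longleftrightarrow> of_rat (a + 6) = (of_rat (w^3 / c - 4 * w) :: 'a)"
    by (simp add: of_rat_add of_rat_diff of_rat_mult of_rat_divide of_rat_power)
  moreover have "of_rat b + 2 * of_rat a = (2 * of_rat w - of_rat w^2 + 4 * of_rat c :: 'a)
      \<longleftrightarrow> of_rat (b + 2 * a) = (of_rat (2 * w - w^2 + 4 * c) :: 'a)"
    by (simp add: of_rat_add of_rat_diff of_rat_mult of_rat_divide of_rat_power)
  ultimately show ?thesis
    unfolding moduli_param_def of_rat_eq_iff of_rat_eq_0_iff by blast
qed

lemma moduli_param_c_rational:
  fixes w c s1 s2 :: "'a::field_char_0"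
  assumes "moduli_param w c s1 s2" "w \<in> \<rat>" "s1 \<in> \<rat>" "s2 \<in> \<rat>"
  shows "c \<in> \<rat>"
proof -
  have "c = (s2 + 2 * s1 - 2 * w + w^2) / 4"
    using assms(1) unfolding moduli_param_def by simp
  moreover have "(s2 + 2 * s1 - 2 * w + w^2) / 4 \<in> \<rat>"
    using assms(2-4) by simp
  ultimately show ?thesis by (simp only:)
qed

lemma C_rat_3_iff: "(a, b) \<in> C_rat 3 \<longleftrightarrow> (\<exists>w c. moduli_param w c a b \<and> 1 + w + c = 0)"
proof
  assume "(a, b) \<in> C_rat 3"
  then obtain w c where wc: "moduli_param w c (of_rat a :: qbar) (of_rat b)" "1 + w + c = 0"
    unfolding C_rat_def C_3_iff by blast
  have w: "w \<in> \<rat>" by (rule period_3_param_rational[OF wc]) simp_all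
  have "c \<in> \<rat>" by (rule moduli_param_c_rational[OF wc(1) w]) simp_all
  then obtain w' c' where e: "w = of_rat w'" "c = of_rat c'"
    using w by (metis Rats_cases)
  have "of_rat (1 + w' + c') = (of_rat 0 :: qbar)"
    using wc(2) by (simp add: e of_rat_add)
  hence "1 + w' + c' = 0" by (simp only: of_rat_eq_iff)
  thus "\<exists>w c. moduli_param w c a b \<and> 1 + w + c = 0"
    using wc(1) unfolding e moduli_param_of_rat by blast
next
  assume "\<exists>w c. moduli_param w c a b \<and> 1 + w + c = 0"
  then obtain w c where wc: "moduli_param w c a b" "1 + w + c = 0" by blast
  have "of_rat (1 + w + c) = (0 :: qbar)" unfolding wc(2) by simp
  hence "1 + of_rat w + of_rat c = (0 :: qbar)" by (simp add: of_rat_add)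
  moreover have "moduli_param (of_rat w :: qbar) (of_rat c) (of_rat a) (of_rat b)"
    unfolding moduli_param_of_rat by (rule wc(1))
  ultimately show "(a, b) \<in> C_rat 3"
    unfolding C_rat_def using C_3_iff by blast
qed

lemma C_rat_4_iff: "(a, b) \<in> C_rat 4 \<longleftrightarrow>
  (\<exists>w c. moduli_param w c a b \<and> 1 + w + c \<noteq> 0 \<and> c + w * (1 + w + c) + (1 + w + c)^2 = 0)"
proof -
  have rel: "1 + of_rat w + of_rat c \<noteq> (0 :: qbar) \<longleftrightarrow> 1 + w + c \<noteq> 0"
    "of_rat c + of_rat w * (1 + of_rat w + of_rat c) + (1 + of_rat w + of_rat c)^2 = (0 :: qbar)
       \<longleftrightarrow> c + w * (1 + w + c) + (1 + w + c)^2 = 0" for w c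
  proof -
    have s: "1 + of_rat w + of_rat c = (of_rat (1 + w + c) :: qbar)" by (simp add: of_rat_add)
    show "1 + of_rat w + of_rat c \<noteq> (0 :: qbar) \<longleftrightarrow> 1 + w + c \<noteq> 0"
      unfolding s of_rat_eq_0_iff ..
    have "of_rat c + of_rat w * of_rat (1 + w + c) + (of_rat (1 + w + c))^2
        = (of_rat (c + w * (1 + w + c) + (1 + w + c)^2) :: qbar)"
      by (simp add: of_rat_add of_rat_mult of_rat_power)
    thus "of_rat c + of_rat w * (1 + of_rat w + of_rat c) + (1 + of_rat w + of_rat c)^2 = (0 :: qbar)
       \<longleftrightarrow> c + w * (1 + w + c) + (1 + w + c)^2 = 0"
      unfolding s by (simp only: of_rat_eq_0_iff)
  qed
  show ?thesis
  proof
    assume "(a, b) \<in> C_rat 4"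
    then obtain w c where wc: "moduli_param w c (of_rat a :: qbar) (of_rat b)" "1 + w + c \<noteq> 0"
      "c + w * (1 + w + c) + (1 + w + c)^2 = 0"
      unfolding C_rat_def C_4_iff by blast
    have w: "w \<in> \<rat>" by (rule period_4_param_rational[OF wc(1,3)]) simp_all
    have "c \<in> \<rat>" by (rule moduli_param_c_rational[OF wc(1) w]) simp_all
    then obtain w' c' where e: "w = of_rat w'" "c = of_rat c'"
      using w by (metis Rats_cases)
    show "\<exists>w c. moduli_param w c a b \<and> 1 + w + c \<noteq> 0 \<and> c + w * (1 + w + c) + (1 + w + c)^2 = 0"
      using wc unfolding e moduli_param_of_rat rel by blast
  next
    assume "\<exists>w c. moduli_param w c a b \<and> 1 + w + c \<noteq> 0 \<and> c + w * (1 + w + c) + (1 + w + c)^2 = 0"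
    then obtain w c where wc: "moduli_param w c a b" "1 + w + c \<noteq> 0"
      "c + w * (1 + w + c) + (1 + w + c)^2 = 0" by blast
    have "moduli_param (of_rat w :: qbar) (of_rat c) (of_rat a) (of_rat b)"
      unfolding moduli_param_of_rat by (rule wc(1))
    moreover note rel(1)[THEN iffD2, OF wc(2)] rel(2)[THEN iffD2, OF wc(3)]
    ultimately show "(a, b) \<in> C_rat 4"
      unfolding C_rat_def using C_4_iff by blast
  qed
qed

lemma moduli_param_unique:
  fixes a b a' b' :: "'a::field_char_0"
  assumes "moduli_param w c a b" "moduli_param w c a' b'"
  shows "a = a'" "b = b'"
proof -
  note m = assms[unfolded moduli_param_def]
  have "a + 6 = a' + 6" using m by metis
  thus a: "a = a'" by simp
  have "b + 2 * a = b' + 2 * a'" using m by metis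
  thus "b = b'" by (simp add: a)
qed

text \<open>
  The line \<open>1 + w + c = 0\<close> is parametrised by \<open>v = c\<close>.
\<close>

lemma moduli_param_eps_rho:
  assumes "v \<noteq> 0"
  shows "moduli_param (- 1 - v) v (eps_fun v) (rho_fun v)"
proof -
  have "eps_fun v + 6 = (- 1 - v)^3 / v - 4 * (- 1 - v)"
    using assms by (simp add: eps_fun_def field_simps power2_eq_square power3_eq_cube)
  moreover have "rho_fun v + 2 * eps_fun v = 2 * (- 1 - v) - (- 1 - v)^2 + 4 * v"
    using assms by (simp add: eps_fun_def rho_fun_def field_simps power2_eq_square power3_eq_cube)
  ultimately show ?thesis using assms unfolding moduli_param_def by blast
qed

text \<open>
  These \<open>w\<close> and \<open>c\<close> are the parametrisation of the conic for period four that is derived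
  in the next lemma.
\<close>

lemma moduli_param_eta_kappa:
  assumes "v \<noteq> 0" "v \<noteq> 1" "v \<noteq> - 1"
  shows "moduli_param ((v^2 - v - 1) / (1 + v)) (v * (1 - v) / (1 + v)) (eta_fun v) (kappa_fun v)"
proof -
  define u where "u = 1 + v"
  define x where "x = v - 1"
  have u: "u \<noteq> 0" and x: "x \<noteq> 0" using assms by (auto simp: u_def x_def add_eq_0_iff)
  define w c where "w = (v^2 - v - 1) / u" and "c = - (v * x) / u"
  have c0: "c \<noteq> 0" using assms(1) u x by (simp add: c_def)
  have k: "kappa_fun v = (v^5 + 2*v^4 + 3*v^3 - 5*v - 2) / (v * x * u)"
    unfolding kappa_fun_def by (rule arg_cong2[of _ _ _ _ "(/)"]) (simp_all add: u_def x_def algebra_simps power2_eq_square)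
  have e: "eta_fun v = - ((v^6 + v^5 + 2*v^4 + 3*v^3 - 2*v^2 - 5*v - 1) / (v * x * u^2))"
    by (simp add: eta_fun_def u_def x_def add.commute)
  have "w^3 / c - 4 * w - 6 = (- ((v^2 - v - 1)^3) - 4 * (v^2 - v - 1) * v * x * u - 6 * v * x * u^2) / (v * x * u^2)"
    unfolding w_def c_def using assms(1) u x
    by (simp add: field_simps power2_eq_square power3_eq_cube)
  also have "- ((v^2 - v - 1)^3) - 4 * (v^2 - v - 1) * v * x * u - 6 * v * x * u^2
      = - (v^6 + v^5 + 2*v^4 + 3*v^3 - 2*v^2 - 5*v - 1)"
    unfolding u_def x_def by (simp add: algebra_simps eval_nat_numeral)
  finally have "w^3 / c - 4 * w - 6 = eta_fun v"
    by (simp only: e minus_divide_left)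
  hence 1: "eta_fun v + 6 = w^3 / c - 4 * w" by linarith
  have "kappa_fun v + 2 * eta_fun v
      = ((v^5 + 2*v^4 + 3*v^3 - 5*v - 2) * u
         - 2 * (v^6 + v^5 + 2*v^4 + 3*v^3 - 2*v^2 - 5*v - 1)) / (v * x * u^2)"
    unfolding e k using assms(1) u x by (simp add: field_simps power2_eq_square)
  also have "(v^5 + 2*v^4 + 3*v^3 - 5*v - 2) * u
         - 2 * (v^6 + v^5 + 2*v^4 + 3*v^3 - 2*v^2 - 5*v - 1)
      = (2 * (v^2 - v - 1) * u - (v^2 - v - 1)^2 - 4 * v * x * u) * (v * x)"
    unfolding u_def x_def by (simp add: algebra_simps eval_nat_numeral)
  also have "\<dots> / (v * x * u^2) = 2 * w - w^2 + 4 * c"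
    unfolding w_def c_def using assms(1) u x by (simp add: field_simps power2_eq_square)
  finally have 2: "kappa_fun v + 2 * eta_fun v = 2 * w - w^2 + 4 * c" .
  have "c = v * (1 - v) / (1 + v)" by (simp add: c_def u_def x_def algebra_simps)
  moreover have "w = (v^2 - v - 1) / (1 + v)" by (simp add: w_def u_def)
  ultimately show ?thesis using c0 1 2 unfolding moduli_param_def by metis
qed

text \<open>
  The condition for period four defines a conic through \<open>(w, c) = (-1, 0)\<close>, where also
  \<open>1 + w + c = 0\<close>; the ratio \<open>c / (1 + w + c) = 1 - v\<close> parametrises it by the lines through that point.
\<close>

lemma period_4_condition_param:
  fixes w c :: "'a::field"
  assumes "c \<noteq> 0" "1 + w + c \<noteq> 0" "c + w * (1 + w + c) + (1 + w + c)^2 = 0"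
  obtains v where "v \<noteq> 0" "v \<noteq> 1" "v \<noteq> - 1" "w = (v^2 - v - 1) / (1 + v)" "c = v * (1 - v) / (1 + v)"
proof -
  define s where "s = 1 + w + c"
  define v where "v = 1 - c / s"
  have s: "s \<noteq> 0" using assms(2) by (simp add: s_def)
  have c: "c = (1 - v) * s" using s by (simp add: v_def)
  have "s * (1 - v + w + s) = 0"
    using assms(3) unfolding s_def[symmetric] by (simp add: c algebra_simps power2_eq_square)
  hence "1 - v + w + s = 0" using s by (simp only: mult_eq_0_iff) simp
  moreover have "s = (1 - v + w + s) + (v - 1 - w)" by simp
  ultimately have s': "s = v - 1 - w" by simp
  have "s = 1 + w + (1 - v) * s" using s_def c by simp
  hence vs: "v * s = 1 + w" by (simp add: algebra_simps)
  hence w: "w * (1 + v) = v^2 - v - 1"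
    unfolding s' by (simp add: algebra_simps power2_eq_square)
  have v1: "v \<noteq> - 1" using w by auto
  have u: "1 + v \<noteq> 0" using v1 by (simp add: add_eq_0_iff)
  have "s * (1 + v) = v"
    using w unfolding s' by (simp add: algebra_simps power2_eq_square)
  hence "s = v / (1 + v)" using u by (simp add: field_simps)
  hence "c = v * (1 - v) / (1 + v)" using c by simp
  moreover have "w = (v^2 - v - 1) / (1 + v)" using w u by (simp add: field_simps)
  moreover have "v \<noteq> 1" using c assms(1) by auto
  moreover have "v \<noteq> 0" using \<open>s = v / (1 + v)\<close> s by auto
  ultimately show ?thesis using v1 that by blast
qed

theorem proposition2p3:
  shows "C_rat 2 = {(v, - 2 * v) | v. True} \<and>
         C_rat 3 = {(eps_fun v, rho_fun v) | v. v \<noteq> 0} \<and>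
         C_rat 4 = {(eta_fun v, kappa_fun v) | v. v \<notin> {0, 1, - 1}}"
proof (intro conjI)
  have "(a, b) \<in> C_rat 2 \<longleftrightarrow> b = - 2 * a" for a b
  proof -
    have "(a, b) \<in> C_rat 2 \<longleftrightarrow> (of_rat b :: qbar) = of_rat (- 2 * a)"
      unfolding C_rat_def by (simp add: C_2_iff of_rat_mult of_rat_minus)
    thus ?thesis by (simp only: of_rat_eq_iff)
  qed
  thus "C_rat 2 = {(v, - 2 * v) | v. True}" by auto
next
  have "(a, b) \<in> C_rat 3 \<longleftrightarrow> (\<exists>v. v \<noteq> 0 \<and> a = eps_fun v \<and> b = rho_fun v)" for a b
  proof
    assume "(a, b) \<in> C_rat 3"
    then obtain w c where wc: "moduli_param w c a b" "1 + w + c = 0"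
      unfolding C_rat_3_iff by blast
    have "c \<noteq> 0" using wc(1) by (simp add: moduli_param_def)
    moreover have "w = - 1 - c" using wc(2) by simp
    ultimately show "\<exists>v. v \<noteq> 0 \<and> a = eps_fun v \<and> b = rho_fun v"
      using moduli_param_unique wc(1) moduli_param_eps_rho by blast
  next
    assume "\<exists>v. v \<noteq> 0 \<and> a = eps_fun v \<and> b = rho_fun v"
    then obtain v where v: "v \<noteq> 0" "a = eps_fun v" "b = rho_fun v" by blast
    have "1 + (- 1 - v) + v = 0" by simp
    thus "(a, b) \<in> C_rat 3"
      unfolding C_rat_3_iff v(2,3) using moduli_param_eps_rho[OF v(1)] by blast
  qed
  thus "C_rat 3 = {(eps_fun v, rho_fun v) | v. v \<noteq> 0}" by auto
next
  have "(a, b) \<in> C_rat 4 \<longleftrightarrow> (\<exists>v. v \<notin> {0, 1, - 1} \<and> a = eta_fun v \<and> b = kappa_fun v)" for a b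
  proof
    assume "(a, b) \<in> C_rat 4"
    then obtain w c where wc: "moduli_param w c a b" "1 + w + c \<noteq> 0"
      "c + w * (1 + w + c) + (1 + w + c)^2 = 0"
      unfolding C_rat_4_iff by blast
    have "c \<noteq> 0" using wc(1) by (simp add: moduli_param_def)
    from period_4_condition_param[OF this wc(2,3)] obtain v where
      v: "v \<noteq> 0" "v \<noteq> 1" "v \<noteq> - 1" "w = (v^2 - v - 1) / (1 + v)" "c = v * (1 - v) / (1 + v)" .
    show "\<exists>v. v \<notin> {0, 1, - 1} \<and> a = eta_fun v \<and> b = kappa_fun v"
      using moduli_param_unique[OF wc(1)[unfolded v(4,5)] moduli_param_eta_kappa[OF v(1-3)]] v(1-3)
      by blast
  next
    assume "\<exists>v. v \<notin> {0, 1, - 1} \<and> a = eta_fun v \<and> b = kappa_fun v"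
    then obtain v where v: "v \<noteq> 0" "v \<noteq> 1" "v \<noteq> - 1" "a = eta_fun v" "b = kappa_fun v" by blast
    define w c where "w = (v^2 - v - 1) / (1 + v)" and "c = v * (1 - v) / (1 + v)"
    have u: "1 + v \<noteq> 0" using v(3) by (simp add: add_eq_0_iff)
    have s: "1 + w + c = v / (1 + v)"
    proof -
      have "1 + w + c = (1 + v) / (1 + v) + w + c" using u by simp
      also have "\<dots> = ((1 + v) + (v^2 - v - 1) + v * (1 - v)) / (1 + v)"
        unfolding w_def c_def by (simp only: add_divide_distrib)
      also have "(1 + v) + (v^2 - v - 1) + v * (1 - v) = v"
        by (simp add: algebra_simps power2_eq_square)
      finally show ?thesis .
    qed
    have "1 + w + c \<noteq> 0" unfolding s using u v(1) by simp
    moreover have "c + w * (1 + w + c) + (1 + w + c)^2 = 0"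
    proof -
      define u where "u = 1 + v"
      have "c + w * (v / u) + (v / u)^2 = (v * (1 - v) * u + (v^2 - v - 1) * v + v^2) / u^2"
        unfolding w_def c_def u_def[symmetric] using u unfolding u_def[symmetric]
        by (simp add: add_divide_distrib power2_eq_square)
      also have "v * (1 - v) * u + (v^2 - v - 1) * v + v^2 = 0"
        unfolding u_def by (simp add: algebra_simps power2_eq_square)
      finally show ?thesis unfolding s u_def by simp
    qed
    ultimately show "(a, b) \<in> C_rat 4"
      unfolding C_rat_4_iff v(4,5) using moduli_param_eta_kappa[OF v(1-3)] unfolding w_def c_def by blast
  qed
  thus "C_rat 4 = {(eta_fun v, kappa_fun v) | v. v \<notin> {0, 1, - 1}}" by auto
qed

end
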